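(* Let $(M,P,g)$ be a Riemannian almost product manifold with $\mathrm{tr}\,P=0$, $\dim M=2n$, $n\ge2$, belonging to the class $\overline{\mathcal W}_3\cup\overline{\mathcal W}_6$, and suppose that its associated 1-form $\theta$ is closed. If $R'$ is the curvature tensor of type $(0,4)$ of a natural connection $\nabla'$ on $(M,P,g)$ with parallel torsion $T$ (i.e. $\nabla'T=0$), then $C(R')=C(K)$.
   Context: A Riemannian almost product manifold $(M,P,g)$ is a differentiable manifold $M$ with a Riemannian metric $g$ and a $(1,1)$-tensor field $P$ such that $P^2x=x$ and $g(Px,Py)=g(x,y)$; here $\mathrm{tr}\,P=0$ and $\dim M=2n$. $x,y,z,w$ denote arbitrary vector fields (or tangent vectors at a point). $\nabla$ is the Levi-Civita connection of $g$, $F(x,y,z)=g((\nabla_xP)y,z)$, and the associated 1-form is $\theta(x)=g^{ij}F(e_i,e_j,x)$ for a local basis $\{e_i\}$. Class $\overline{\mathcal W}_3$: $F(x,y,z)=\frac1{2n}\{[g(x,y)+g(x,Py)]\theta(z)+[g(x,z)+g(x,Pz)]\theta(y)\}$ and $\theta(Px)=-\theta(x)$. Class $\overline{\mathcal W}_6$: $F(x,y,z)=\frac1{2n}\{[g(x,y)-g(x,Py)]\theta(z)+[g(x,z)-g(x,Pz)]\theta(y)\}$ and $\theta(Px)=\theta(x)$. $(M,P,g)\in\overline{\mathcal W}_3\cup\overline{\mathcal W}_6$ means that $(M,P,g)$ belongs to one of these two classes. A natural connection is a linear connection $\nabla'$ with $\nabla'P=\nabla'g=0$; on these manifolds the natural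 connections considered are those of the 2-parameter family ($\lambda,\mu\in\mathbb R$) whose torsion $T(x,y,z)=g(T(x,y),z)$ is $$T(x,y,z)=\tfrac1{2n}\{g(y,z)\theta(Px)-g(x,z)\theta(Py)\}+\lambda\{g(y,z)\theta(x)-g(x,z)\theta(y)+g(y,Pz)\theta(Px)-g(x,Pz)\theta(Py)\}+\mu\{g(y,Pz)\theta(x)-g(x,Pz)\theta(y)+g(y,z)\theta(Px)-g(x,z)\theta(Py)\}.$$ Curvature: $R(x,y)z=\nabla_x\nabla_yz-\nabla_y\nabla_xz-\nabla_{[x,y]}z$, $R(x,y,z,w)=g(R(x,y)z,w)$, and $R'$ is defined in the same way from $\nabla'$. The tensor $K$ is $K(x,y,z,w)=\frac12[R(x,y,z,w)+R(x,y,Pz,Pw)]$. A curvature-like tensor is a $(0,4)$-tensor $L$ with $L(x,y,z,w)=-L(y,x,z,w)=-L(x,y,w,z)$ and $L(x,y,z,w)+L(y,z,x,w)+L(z,x,y,w)=0$; it is a Riemannian $P$-tensor if also $L(x,y,Pz,Pw)=L(x,y,z,w)$. (Under the hypotheses, $K$ and $R'$ are Riemannian $P$-tensors.) For such $L$: $\rho(L)(y,z)=g^{ij}L(e_i,y,z,e_j)$, $\tau(L)=g^{ij}\rho(L)(e_i,e_j)$, $\rho^*(L)(y,z)=g^{ij}L(e_i,y,z,Pe_j)$, $\tau^*(L)=g^{ij}\rho^*(L)(e_i,e_j)$. For a $(0,2)$-tensor $S$: $\psi_1(S)(x,y,z,w)=g(y,z)S(x,w)-g(x,z)S(y,w)+S(y,z)g(x,w)-S(x,z)g(y,w)$,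 $\psi_2(S)(x,y,z,w)=\psi_1(S)(x,y,Pz,Pw)$. With $\widetilde g(x,y)=g(x,Py)$: $\pi_1=\frac12\psi_1(g)$, $\pi_2=\frac12\psi_2(g)$, $\pi_3=\psi_1(\widetilde g)=\psi_2(\widetilde g)$. For a Riemannian $P$-tensor $L$, $$C(L)=L-\frac{\tau(L)(\pi_1+\pi_2)+\tau^*(L)\pi_3}{4n(n-1)}.$$ *)

theory Defs
  imports "HOL-Analysis.Analysis" "HOL-Library.Function_Algebras"
begin

text \<open>
  HOL-Analysis has no smooth manifolds, so the calculus needed is set up here along the usual
  textbook lines: smooth atlases, tangent vectors as derivations at a point of the algebra of
  smooth functions, linear connections as operators on global smooth vector fields.
  Sums, differences and zero of functions (hence of tangent vectors and of vector fields)
  are the pointwise ones of \<^theory>\<open>HOL-Library.Function_Algebras\<close>.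
\<close>

section \<open>Smooth manifolds\<close>

primrec Ck_on :: "nat \<Rightarrow> (real^'m \<Rightarrow> real) \<Rightarrow> (real^'m) set \<Rightarrow> bool" where
  "Ck_on 0 f S \<longleftrightarrow> continuous_on S f"
| "Ck_on (Suc k) f S \<longleftrightarrow> f differentiable_on S \<and>
     (\<forall>i. Ck_on k (\<lambda>x. frechet_derivative f (at x) (axis i 1)) S)"

text \<open>Only used for open \<open>S\<close>; there the full derivative at \<open>x\<close> agrees with the one within \<open>S\<close>.\<close>

definition smooth_on :: "(real^'m \<Rightarrow> real) \<Rightarrow> (real^'m) set \<Rightarrow> bool" where
  "smooth_on f S \<longleftrightarrow> (\<forall>k. Ck_on k f S)"

text \<open>A chart is a pair of its domain and its coordinate map (irrelevant outside the domain).\<close>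

type_synonym ('a, 'm) chart = "'a set \<times> ('a \<Rightarrow> real^'m)"

text \<open>The manifold is the whole type \<open>'a\<close> (Hausdorff and second countable); its dimension
  is \<open>CARD('m)\<close>.\<close>

definition smooth_atlas ::
  "('a::{t2_space,second_countable_topology}, 'm::finite) chart set \<Rightarrow> bool" where
  "smooth_atlas A \<longleftrightarrow>
     (\<Union>(U,\<phi>)\<in>A. U) = UNIV \<and>
     (\<forall>(U,\<phi>)\<in>A. open U \<and> open (\<phi> ` U) \<and> homeomorphism U (\<phi> ` U) \<phi> (inv_into U \<phi>)) \<and>
     (\<forall>(U,\<phi>)\<in>A. \<forall>(V,\<psi>)\<in>A. \<forall>i. smooth_on (\<lambda>x. \<psi> (inv_into U \<phi> x) $ i) (\<phi> ` (U \<inter> V)))"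

definition Cinf :: "('a, 'm::finite) chart set \<Rightarrow> ('a \<Rightarrow> real) set" where
  "Cinf A = {f. \<forall>(U,\<phi>)\<in>A. smooth_on (\<lambda>x. f (inv_into U \<phi> x)) (\<phi> ` U)}"

type_synonym 'a tangent = "('a \<Rightarrow> real) \<Rightarrow> real"

type_synonym 'a vfield = "'a \<Rightarrow> 'a tangent"

text \<open>Functions that are not smooth are sent to \<open>0\<close>, so that a tangent vector is
  determined by its values on the algebra of smooth functions.\<close>

definition tangent_space :: "('a, 'm::finite) chart set \<Rightarrow> 'a \<Rightarrow> 'a tangent set" where
  "tangent_space A p = {v.
     (\<forall>f\<in>Cinf A. \<forall>h\<in>Cinf A. \<forall>a b. v (\<lambda>q. a * f q + b * h q) = a * v f + b * v h) \<and>
     (\<forall>f\<in>Cinf A. \<forall>h\<in>Cinf A. v (\<lambda>q. f q * h q) = f p * v h + h p * v f) \<and>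
     (\<forall>f. f \<notin> Cinf A \<longrightarrow> v f = 0)}"

definition vfields :: "('a, 'm::finite) chart set \<Rightarrow> 'a vfield set" where
  "vfields A = {X. (\<forall>p. X p \<in> tangent_space A p) \<and>
     (\<forall>f\<in>Cinf A. (\<lambda>p. X p f) \<in> Cinf A)}"

definition tscale :: "real \<Rightarrow> 'a tangent \<Rightarrow> 'a tangent" (infixr "*\<^sub>t" 75) where
  "a *\<^sub>t v = (\<lambda>f. a * v f)"

definition fscale :: "('a \<Rightarrow> real) \<Rightarrow> 'a vfield \<Rightarrow> 'a vfield" (infixr "*\<^sub>v" 75) where
  "f *\<^sub>v X = (\<lambda>p. f p *\<^sub>t X p)"

definition act :: "'a vfield \<Rightarrow> ('a \<Rightarrow> real) \<Rightarrow> 'a \<Rightarrow> real" where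
  "act X f = (\<lambda>p. X p f)"

definition bracket :: "'a vfield \<Rightarrow> 'a vfield \<Rightarrow> 'a vfield" where
  "bracket X Y = (\<lambda>p f. act X (act Y f) p - act Y (act X f) p)"

definition tangent_basis :: "('a, 'm::finite) chart set \<Rightarrow> 'a \<Rightarrow> ('m \<Rightarrow> 'a tangent) \<Rightarrow> bool" where
  "tangent_basis A p e \<longleftrightarrow> (\<forall>i. e i \<in> tangent_space A p) \<and>
     (\<forall>v\<in>tangent_space A p. \<exists>!c::real^'m. v = (\<Sum>i\<in>UNIV. (c $ i) *\<^sub>t e i))"

text \<open>Vector fields forming a basis at \<open>p\<close>, and therefore a local basis near \<open>p\<close>.\<close>

definition local_basis :: "('a, 'm::finite) chart set \<Rightarrow> 'a \<Rightarrow> ('m \<Rightarrow> 'a vfield) \<Rightarrow> bool" where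
  "local_basis A p e \<longleftrightarrow> (\<forall>i. e i \<in> vfields A) \<and> tangent_basis A p (\<lambda>i. e i p)"

section \<open>Riemannian almost product manifolds\<close>

type_synonym 'a metric = "'a \<Rightarrow> 'a tangent \<Rightarrow> 'a tangent \<Rightarrow> real"

type_synonym 'a endo = "'a \<Rightarrow> 'a tangent \<Rightarrow> 'a tangent"

definition metric_app :: "'a metric \<Rightarrow> 'a vfield \<Rightarrow> 'a vfield \<Rightarrow> 'a \<Rightarrow> real" where
  "metric_app g X Y = (\<lambda>p. g p (X p) (Y p))"

definition endo_app :: "'a endo \<Rightarrow> 'a vfield \<Rightarrow> 'a vfield" where
  "endo_app P X = (\<lambda>p. P p (X p))"

definition riemannian_metric :: "('a, 'm::finite) chart set \<Rightarrow> 'a metric \<Rightarrow> bool" where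
  "riemannian_metric A g \<longleftrightarrow>
     (\<forall>p. \<forall>u\<in>tangent_space A p. \<forall>v\<in>tangent_space A p. \<forall>w\<in>tangent_space A p. \<forall>a b.
        g p (a *\<^sub>t u + b *\<^sub>t v) w = a * g p u w + b * g p v w) \<and>
     (\<forall>p. \<forall>u\<in>tangent_space A p. \<forall>v\<in>tangent_space A p. g p u v = g p v u) \<and>
     (\<forall>p. \<forall>v\<in>tangent_space A p. v \<noteq> 0 \<longrightarrow> g p v v > 0) \<and>
     (\<forall>X\<in>vfields A. \<forall>Y\<in>vfields A. metric_app g X Y \<in> Cinf A)"

definition endo_field :: "('a, 'm::finite) chart set \<Rightarrow> 'a endo \<Rightarrow> bool" where
  "endo_field A P \<longleftrightarrow>
     (\<forall>p. \<forall>v\<in>tangent_space A p. P p v \<in> tangent_space A p) \<and>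
     (\<forall>p. \<forall>u\<in>tangent_space A p. \<forall>v\<in>tangent_space A p. \<forall>a b.
        P p (a *\<^sub>t u + b *\<^sub>t v) = a *\<^sub>t P p u + b *\<^sub>t P p v) \<and>
     (\<forall>X\<in>vfields A. endo_app P X \<in> vfields A)"

definition riemannian_almost_product ::
  "('a::{t2_space,second_countable_topology}, 'm::finite) chart set \<Rightarrow> 'a endo \<Rightarrow> 'a metric \<Rightarrow> bool"
  where
  "riemannian_almost_product A P g \<longleftrightarrow>
     smooth_atlas A \<and> riemannian_metric A g \<and> endo_field A P \<and>
     (\<forall>p. \<forall>u\<in>tangent_space A p. \<forall>v\<in>tangent_space A p.
        P p (P p v) = v \<and> g p (P p u) (P p v) = g p u v)"

definition endo_trace :: "('a, 'm::finite) chart set \<Rightarrow> 'a endo \<Rightarrow> 'a \<Rightarrow> real" where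
  "endo_trace A P p = (THE t. \<exists>(e::'m \<Rightarrow> 'a tangent) (M::real^'m^'m). tangent_basis A p e \<and>
     (\<forall>j. P p (e j) = (\<Sum>i\<in>UNIV. (M $ i $ j) *\<^sub>t e i)) \<and> t = trace M)"

text \<open>Fields of covariant tensors are represented as functions of vector fields; \<open>contr A g S\<close>
  is \<open>g\<^sup>i\<^sup>j S(e\<^sub>i,e\<^sub>j)\<close>, which for tensorial \<open>S\<close> does not depend on the chosen local basis.\<close>

type_synonym 'a tensor2 = "'a vfield \<Rightarrow> 'a vfield \<Rightarrow> 'a \<Rightarrow> real"

type_synonym 'a tensor4 = "'a vfield \<Rightarrow> 'a vfield \<Rightarrow> 'a vfield \<Rightarrow> 'a vfield \<Rightarrow> 'a \<Rightarrow> real"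

definition contr :: "('a, 'm::finite) chart set \<Rightarrow> 'a metric \<Rightarrow> 'a tensor2 \<Rightarrow> 'a \<Rightarrow> real" where
  "contr A g S p =
     (let e = (SOME e. local_basis A p e);
          G = (\<chi> i j. metric_app g (e i) (e j) p) :: real^'m^'m
      in \<Sum>i\<in>UNIV. \<Sum>j\<in>UNIV. matrix_inv G $ i $ j * S (e i) (e j) p)"

section \<open>Connections and curvature\<close>

type_synonym 'a connection = "'a vfield \<Rightarrow> 'a vfield \<Rightarrow> 'a vfield"

definition linear_connection :: "('a, 'm::finite) chart set \<Rightarrow> 'a connection \<Rightarrow> bool" where
  "linear_connection A D \<longleftrightarrow>
     (\<forall>X\<in>vfields A. \<forall>Y\<in>vfields A. D X Y \<in> vfields A) \<and>
     (\<forall>X\<in>vfields A. \<forall>Y\<in>vfields A. \<forall>Z\<in>vfields A.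
        D (X + Y) Z = D X Z + D Y Z \<and> D X (Y + Z) = D X Y + D X Z) \<and>
     (\<forall>f\<in>Cinf A. \<forall>X\<in>vfields A. \<forall>Y\<in>vfields A.
        D (f *\<^sub>v X) Y = f *\<^sub>v D X Y \<and> D X (f *\<^sub>v Y) = act X f *\<^sub>v Y + f *\<^sub>v D X Y)"

definition torsion :: "'a connection \<Rightarrow> 'a vfield \<Rightarrow> 'a vfield \<Rightarrow> 'a vfield" where
  "torsion D X Y = D X Y - D Y X - bracket X Y"

definition cov_endo :: "'a connection \<Rightarrow> 'a endo \<Rightarrow> 'a vfield \<Rightarrow> 'a vfield \<Rightarrow> 'a vfield" where
  "cov_endo D P X Y = D X (endo_app P Y) - endo_app P (D X Y)"

definition cov_metric ::
  "'a connection \<Rightarrow> 'a metric \<Rightarrow> 'a vfield \<Rightarrow> 'a vfield \<Rightarrow> 'a vfield \<Rightarrow> 'a \<Rightarrow> real" where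
  "cov_metric D g X Y Z =
     act X (metric_app g Y Z) - metric_app g (D X Y) Z - metric_app g Y (D X Z)"

definition cov_torsion ::
  "'a connection \<Rightarrow> 'a vfield \<Rightarrow> 'a vfield \<Rightarrow> 'a vfield \<Rightarrow> 'a vfield" where
  "cov_torsion D W X Y = D W (torsion D X Y) - torsion D (D W X) Y - torsion D X (D W Y)"

definition metric_connection ::
  "('a, 'm::finite) chart set \<Rightarrow> 'a metric \<Rightarrow> 'a connection \<Rightarrow> bool" where
  "metric_connection A g D \<longleftrightarrow>
     (\<forall>X\<in>vfields A. \<forall>Y\<in>vfields A. \<forall>Z\<in>vfields A. cov_metric D g X Y Z = 0)"

definition levi_civita :: "('a, 'm::finite) chart set \<Rightarrow> 'a metric \<Rightarrow> 'a connection \<Rightarrow> bool" where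
  "levi_civita A g D \<longleftrightarrow> linear_connection A D \<and> metric_connection A g D \<and>
     (\<forall>X\<in>vfields A. \<forall>Y\<in>vfields A. torsion D X Y = 0)"

definition parallel_torsion :: "('a, 'm::finite) chart set \<Rightarrow> 'a connection \<Rightarrow> bool" where
  "parallel_torsion A D \<longleftrightarrow>
     (\<forall>W\<in>vfields A. \<forall>X\<in>vfields A. \<forall>Y\<in>vfields A. cov_torsion D W X Y = 0)"

definition curv :: "'a connection \<Rightarrow> 'a vfield \<Rightarrow> 'a vfield \<Rightarrow> 'a vfield \<Rightarrow> 'a vfield" where
  "curv D X Y Z = D X (D Y Z) - D Y (D X Z) - D (bracket X Y) Z"

definition curv4 :: "'a connection \<Rightarrow> 'a metric \<Rightarrow> 'a tensor4" where
  "curv4 D g X Y Z W = metric_app g (curv D X Y Z) W"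

section \<open>The fundamental tensor, the classes and natural connections\<close>

text \<open>In the rest, \<open>D\<close> is the Levi-Civita connection where \<open>tensorF\<close> and \<open>lee\<close> are concerned.\<close>

definition tensorF ::
  "'a connection \<Rightarrow> 'a endo \<Rightarrow> 'a metric \<Rightarrow> 'a vfield \<Rightarrow> 'a vfield \<Rightarrow> 'a vfield \<Rightarrow> 'a \<Rightarrow> real" where
  "tensorF D P g X Y Z = metric_app g (cov_endo D P X Y) Z"

definition lee :: "('a, 'm::finite) chart set \<Rightarrow> 'a connection \<Rightarrow> 'a endo \<Rightarrow> 'a metric \<Rightarrow>
    'a vfield \<Rightarrow> 'a \<Rightarrow> real" where
  "lee A D P g Z = contr A g (\<lambda>X Y. tensorF D P g X Y Z)"

text \<open>\<open>\<theta>\<close> is closed: \<open>d\<theta>(X,Y) = X \<theta>(Y) - Y \<theta>(X) - \<theta>([X,Y]) = 0\<close>.\<close>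

definition closed_form :: "('a, 'm::finite) chart set \<Rightarrow> ('a vfield \<Rightarrow> 'a \<Rightarrow> real) \<Rightarrow> bool" where
  "closed_form A \<theta> \<longleftrightarrow>
     (\<forall>X\<in>vfields A. \<forall>Y\<in>vfields A. act X (\<theta> Y) - act Y (\<theta> X) - \<theta> (bracket X Y) = 0)"

definition class_W3 :: "nat \<Rightarrow> ('a, 'm::finite) chart set \<Rightarrow> 'a connection \<Rightarrow> 'a endo \<Rightarrow>
    'a metric \<Rightarrow> bool" where
  "class_W3 n A D P g \<longleftrightarrow>
     (let G = metric_app g; J = endo_app P; \<theta> = lee A D P g in
      (\<forall>x\<in>vfields A. \<forall>y\<in>vfields A. \<forall>z\<in>vfields A. \<forall>p.
         tensorF D P g x y z p =
           1 / (2 * real n) * ((G x y p + G x (J y) p) * \<theta> z p + (G x z p + G x (J z) p) * \<theta> y p)) \<and>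
      (\<forall>x\<in>vfields A. \<forall>p. \<theta> (J x) p = - \<theta> x p))"

definition class_W6 :: "nat \<Rightarrow> ('a, 'm::finite) chart set \<Rightarrow> 'a connection \<Rightarrow> 'a endo \<Rightarrow>
    'a metric \<Rightarrow> bool" where
  "class_W6 n A D P g \<longleftrightarrow>
     (let G = metric_app g; J = endo_app P; \<theta> = lee A D P g in
      (\<forall>x\<in>vfields A. \<forall>y\<in>vfields A. \<forall>z\<in>vfields A. \<forall>p.
         tensorF D P g x y z p =
           1 / (2 * real n) * ((G x y p - G x (J y) p) * \<theta> z p + (G x z p - G x (J z) p) * \<theta> y p)) \<and>
      (\<forall>x\<in>vfields A. \<forall>p. \<theta> (J x) p = \<theta> x p))"

text \<open>Here \<open>D\<close> is the Levi-Civita connection (it enters through \<open>\<theta>\<close>) and \<open>D'\<close> the natural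
  connection with parameters \<open>a\<close>, \<open>b\<close> (the \<open>\<lambda>\<close>, \<open>\<mu>\<close> of the two-parameter family).\<close>

definition natural_connection :: "nat \<Rightarrow> ('a, 'm::finite) chart set \<Rightarrow> 'a connection \<Rightarrow>
    'a endo \<Rightarrow> 'a metric \<Rightarrow> real \<Rightarrow> real \<Rightarrow> 'a connection \<Rightarrow> bool" where
  "natural_connection n A D P g a b D' \<longleftrightarrow>
     linear_connection A D' \<and> metric_connection A g D' \<and>
     (\<forall>x\<in>vfields A. \<forall>y\<in>vfields A. cov_endo D' P x y = 0) \<and>
     (let G = metric_app g; J = endo_app P; \<theta> = lee A D P g in
      \<forall>x\<in>vfields A. \<forall>y\<in>vfields A. \<forall>z\<in>vfields A. \<forall>p.
        G (torsion D' x y) z p =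
          1 / (2 * real n) * (G y z p * \<theta> (J x) p - G x z p * \<theta> (J y) p)
          + a * (G y z p * \<theta> x p - G x z p * \<theta> y p
                 + G y (J z) p * \<theta> (J x) p - G x (J z) p * \<theta> (J y) p)
          + b * (G y (J z) p * \<theta> x p - G x (J z) p * \<theta> y p
                 + G y z p * \<theta> (J x) p - G x z p * \<theta> (J y) p))"

section \<open>Curvature-like tensors and the tensor \<open>C(L)\<close>\<close>

definition tensorK :: "'a connection \<Rightarrow> 'a endo \<Rightarrow> 'a metric \<Rightarrow> 'a tensor4" where
  "tensorK D P g x y z w p =
     1 / 2 * (curv4 D g x y z w p + curv4 D g x y (endo_app P z) (endo_app P w) p)"

definition ricci :: "('a, 'm::finite) chart set \<Rightarrow> 'a metric \<Rightarrow> 'a tensor4 \<Rightarrow> 'a tensor2" where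
  "ricci A g L y z = contr A g (\<lambda>u v. L u y z v)"

definition scal :: "('a, 'm::finite) chart set \<Rightarrow> 'a metric \<Rightarrow> 'a tensor4 \<Rightarrow> 'a \<Rightarrow> real" where
  "scal A g L = contr A g (ricci A g L)"

definition ricci_star :: "('a, 'm::finite) chart set \<Rightarrow> 'a endo \<Rightarrow> 'a metric \<Rightarrow> 'a tensor4 \<Rightarrow>
    'a tensor2" where
  "ricci_star A P g L y z = contr A g (\<lambda>u v. L u y z (endo_app P v))"

definition scal_star :: "('a, 'm::finite) chart set \<Rightarrow> 'a endo \<Rightarrow> 'a metric \<Rightarrow> 'a tensor4 \<Rightarrow>
    'a \<Rightarrow> real" where
  "scal_star A P g L = contr A g (ricci_star A P g L)"

definition psi1 :: "'a metric \<Rightarrow> 'a tensor2 \<Rightarrow> 'a tensor4" where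
  "psi1 g S x y z w p =
     metric_app g y z p * S x w p - metric_app g x z p * S y w p
     + S y z p * metric_app g x w p - S x z p * metric_app g y w p"

definition psi2 :: "'a endo \<Rightarrow> 'a metric \<Rightarrow> 'a tensor2 \<Rightarrow> 'a tensor4" where
  "psi2 P g S x y z w p = psi1 g S x y (endo_app P z) (endo_app P w) p"

definition assoc_metric :: "'a endo \<Rightarrow> 'a metric \<Rightarrow> 'a tensor2" where
  "assoc_metric P g x y = metric_app g x (endo_app P y)"

definition pi1 :: "'a metric \<Rightarrow> 'a tensor4" where
  "pi1 g x y z w p = 1 / 2 * psi1 g (metric_app g) x y z w p"

definition pi2 :: "'a endo \<Rightarrow> 'a metric \<Rightarrow> 'a tensor4" where
  "pi2 P g x y z w p = 1 / 2 * psi2 P g (metric_app g) x y z w p"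

definition pi3 :: "'a endo \<Rightarrow> 'a metric \<Rightarrow> 'a tensor4" where
  "pi3 P g = psi1 g (assoc_metric P g)"

definition tensorC :: "nat \<Rightarrow> ('a, 'm::finite) chart set \<Rightarrow> 'a endo \<Rightarrow> 'a metric \<Rightarrow>
    'a tensor4 \<Rightarrow> 'a tensor4" where
  "tensorC n A P g L x y z w p =
     L x y z w p
     - (scal A g L p * (pi1 g x y z w p + pi2 P g x y z w p) + scal_star A P g L p * pi3 P g x y z w p)
       / (4 * real n * (real n - 1))"

end

theory Submission
  imports Defs
begin

text \<open>
  The two classes are treated together: with \<open>\<delta> = 1\<close> for the third and \<open>\<delta> = -1\<close> for the sixth class,
  \<open>\<theta>(Px) = -\<delta> \<theta>(x)\<close>, and the torsion of the natural connection becomes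
  \<open>T(x,y,z) = \<theta>(x) B(y,z) - \<theta>(y) B(x,z)\<close> with \<open>B(x,y) = \<alpha> g(x,y) + \<beta> g(x,Py)\<close>, where
  \<open>\<alpha> = a - \<delta>(1/(2n) + b)\<close> and \<open>\<beta> = b - \<delta>a\<close>. As \<open>\<alpha> + \<delta>\<beta> = -\<delta>/(2n)\<close>, not both of \<open>\<alpha>\<close>, \<open>\<beta>\<close> are \<open>0\<close>.
  The difference \<open>Q(x,y) = \<nabla>'\<^sub>x y - \<nabla>\<^sub>x y\<close> satisfies
  \<open>g(Q(x,y),z) = B(x,y) \<theta>(z) - B(x,z) \<theta>(y)\<close> (lemma \<open>G_Q\<close>).

  Since \<open>B\<close> is parallel for \<open>\<nabla>'\<close>, parallel torsion says that \<open>\<eta>(x) B(y,z) = \<eta>(y) B(x,z)\<close> for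
  \<open>\<eta> = \<nabla>'\<^sub>w \<theta>\<close>. If \<open>\<eta>\<close> were not \<open>0\<close>, then \<open>B\<close> would have rank at most one and the two scalar contractions
  of \<open>B(y,z) B(x,w) - B(x,z) B(y,w) = \<alpha>\<^sup>2 \<pi>\<^sub>1 + \<alpha>\<beta> \<pi>\<^sub>3 + \<beta>\<^sup>2 \<pi>\<^sub>2\<close> would force \<open>\<alpha> = \<beta> = 0\<close>. Hence \<open>\<theta>\<close>, and
  with it \<open>Q\<close>, is parallel (\<open>lee_parallel\<close>, \<open>Q_parallel\<close>), so \<open>R' = R + Q(T(x,y),_) - [Q\<^sub>x,Q\<^sub>y]\<close>
  (\<open>curv_difference\<close>). Now \<open>R'(x,y,Pz,Pw) = R'(x,y,z,w)\<close>, and averaging \<open>R' - R\<close> over \<open>(z,w)\<close> and \<open>(Pz,Pw)\<close>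
  cancels all terms that contain \<open>\<theta>\<close> explicitly:
  \<open>R' = K + |\<theta>|\<^sup>2 [(\<alpha>\<^sup>2 + \<beta>\<^sup>2)/2 (\<pi>\<^sub>1 + \<pi>\<^sub>2) + \<alpha>\<beta> \<pi>\<^sub>3]\<close> (\<open>curv_eq_K\<close>). The map \<open>C\<close> is linear and kills
  \<open>\<pi>\<^sub>1 + \<pi>\<^sub>2\<close> and \<open>\<pi>\<^sub>3\<close> (\<open>scal_pi_comb\<close>).

  The contractions are defined through a choice of vector fields forming a basis at the given point,
  so their existence is needed: \<open>local_basis_exists\<close> is the theorem that the derivations at a point of
  a manifold form a space with basis the coordinate derivations, proved from bump functions and
  Hadamard's lemma.
\<close>

section \<open>Calculus of smooth functions on open sets\<close>

lemma Ck_on_subset: "Ck_on k f S \<Longrightarrow> T \<subseteq> S \<Longrightarrow> Ck_on k f T"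
proof (induction k arbitrary: f)
  case 0
  then show ?case by (auto intro: continuous_on_subset)
next
  case (Suc k)
  then show ?case by (auto intro: differentiable_on_subset)
qed

lemma frechet_derivative_cong_open:
  assumes "open S" "x \<in> S" "\<And>y. y \<in> S \<Longrightarrow> f y = h y"
  shows "frechet_derivative f (at x) = frechet_derivative h (at x)"
proof -
  have "\<And>D. (f has_derivative D) (at x) \<longleftrightarrow> (h has_derivative D) (at x)"
    using assms has_derivative_transform_within_open[of _ _ x UNIV S]
    by (metis)
  then show ?thesis unfolding frechet_derivative_def by simp
qed

lemma Ck_on_cong:
  assumes "open S" "\<And>y. y \<in> S \<Longrightarrow> f y = h y" "Ck_on k f S"
  shows "Ck_on k h S"
  using assms(2,3)
proof (induction k arbitrary: f h)
  case 0
  then show ?case using continuous_on_cong[of S S f h] by auto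
next
  case (Suc k)
  have "h differentiable_on S"
    using Suc.prems unfolding Ck_on.simps differentiable_on_def
    by (metis differentiable_transform_within zero_less_one)
  moreover have "Ck_on k (\<lambda>x. frechet_derivative h (at x) (axis i 1)) S" for i
    by (rule Suc.IH[of "\<lambda>x. frechet_derivative f (at x) (axis i 1)"])
      (use Suc.prems frechet_derivative_cong_open[OF assms(1), of _ f h] in auto)
  ultimately show ?case by simp
qed

text \<open>Any derivative serves in place of the Frechet derivative operator of the definition, since
  derivatives at interior points are unique.\<close>

lemma Ck_on_SucI:
  assumes "open S" "\<And>x. x \<in> S \<Longrightarrow> (f has_derivative f' x) (at x)"
    "\<And>i. Ck_on k (\<lambda>x. f' x (axis i 1)) S"
  shows "Ck_on (Suc k) f S"
proof -
  have "f differentiable_on S"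
    using assms(2) by (auto simp: differentiable_on_def differentiable_def intro: has_derivative_at_withinI)
  moreover have "Ck_on k (\<lambda>x. frechet_derivative f (at x) (axis i 1)) S" for i
    by (rule Ck_on_cong[OF assms(1) _ assms(3)[of i]]) (use assms(2) frechet_derivative_at in metis)
  ultimately show ?thesis by simp
qed

lemma Ck_on_Suc_has_derivative:
  assumes "open S" "Ck_on (Suc k) f S" "x \<in> S"
  shows "(f has_derivative frechet_derivative f (at x)) (at x)"
  using assms differentiable_on_eq_differentiable_at[OF assms(1)] frechet_derivative_works by auto

lemma Ck_on_SucD:
  assumes "Ck_on (Suc k) f S" shows "Ck_on k f S"
  using assms
proof (induction k arbitrary: f)
  case 0
  then show ?case by (auto intro: differentiable_imp_continuous_on)
qed auto

lemma Ck_on_const: "Ck_on k (\<lambda>x. c) S"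
proof (induction k arbitrary: c)
  case (Suc k)
  have "frechet_derivative (\<lambda>x::real^'a. c) (at y) = (\<lambda>_. 0)" for y
    using has_derivative_const frechet_derivative_at by metis
  with Suc show ?case by simp
qed simp

lemma Ck_on_component:
  assumes "open S" shows "Ck_on k (\<lambda>x. x $ i) S"
proof (cases k)
  case 0 then show ?thesis by (auto intro: continuous_intros)
next
  case (Suc k)
  show ?thesis unfolding Suc
    by (rule Ck_on_SucI[OF assms, where f' = "\<lambda>x v. v $ i"])
      (rule bounded_linear_imp_has_derivative[OF bounded_linear_vec_nth], rule Ck_on_const)
qed

lemma Ck_on_add:
  assumes "open S" "Ck_on k f S" "Ck_on k h S"
  shows "Ck_on k (\<lambda>x. f x + h x) S"
  using assms(2,3)
proof (induction k arbitrary: f h)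
  case 0 then show ?case by (auto intro: continuous_intros)
next
  case (Suc k)
  note d = Ck_on_Suc_has_derivative[OF assms(1)]
  show ?case
    by (rule Ck_on_SucI[OF assms(1) has_derivative_add[OF d[OF Suc.prems(1)] d[OF Suc.prems(2)]]])
      (use Suc in auto)
qed

lemma Ck_on_mult:
  assumes "open S" "Ck_on k f S" "Ck_on k h S"
  shows "Ck_on k (\<lambda>x. f x * h x) S"
  using assms(2,3)
proof (induction k arbitrary: f h)
  case 0 then show ?case by (auto intro: continuous_intros)
next
  case (Suc k)
  note d = Ck_on_Suc_has_derivative[OF assms(1)]
  show ?case
    by (rule Ck_on_SucI[OF assms(1) has_derivative_mult[OF d[OF Suc.prems(1)] d[OF Suc.prems(2)]]])
      (use Suc.prems Suc.IH Ck_on_SucD[OF Suc.prems(1)] Ck_on_SucD[OF Suc.prems(2)]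
        in \<open>auto intro!: Ck_on_add assms(1)\<close>)
qed

lemma Ck_on_sum:
  assumes "open S" "finite I" "\<And>i. i \<in> I \<Longrightarrow> Ck_on k (f i) S"
  shows "Ck_on k (\<lambda>x. \<Sum>i\<in>I. f i x) S"
  using assms(2,3)
  by (induction I rule: finite_induct) (auto intro: Ck_on_const Ck_on_add[OF assms(1)])

lemma Ck_on_inverse:
  assumes "open S" "Ck_on k f S" "\<And>x. x \<in> S \<Longrightarrow> f x \<noteq> 0"
  shows "Ck_on k (\<lambda>x. inverse (f x)) S"
  using assms(2)
proof (induction k)
  case 0 then show ?case using assms(3) by (auto intro: continuous_intros)
next
  case (Suc k)
  note d = Ck_on_Suc_has_derivative[OF assms(1) Suc.prems]
  have IH: "Ck_on k (\<lambda>x. inverse (f x)) S" using Suc Ck_on_SucD by blast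
  have "Ck_on k (\<lambda>x. (- 1) * (inverse (f x) * frechet_derivative f (at x) (axis i 1) * inverse (f x))) S" for i
    using Suc.prems by (intro Ck_on_mult Ck_on_const assms(1) IH) auto
  then show ?case
    by (intro Ck_on_SucI[OF assms(1) Deriv.has_derivative_inverse[OF assms(3) d]]) auto
qed

lemma linear_eq_sum_axis:
  fixes L :: "real^'m \<Rightarrow> real"
  assumes "linear L"
  shows "L v = (\<Sum>i\<in>UNIV. v $ i * L (axis i 1))"
proof -
  have "(\<Sum>i\<in>UNIV. (v $ i) *\<^sub>R axis i 1) = v"
    by (simp add: basis_expansion flip: scalar_mult_eq_scaleR)
  moreover have "L (\<Sum>i\<in>UNIV. (v $ i) *\<^sub>R axis i 1) = (\<Sum>i\<in>UNIV. v $ i * L (axis i 1))"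
    using assms by (simp add: linear_sum linear_scale)
  ultimately show ?thesis by simp
qed

lemma Ck_on_compose:
  fixes G :: "real^'m \<Rightarrow> real^'l"
  assumes "open S" "open T" "G ` S \<subseteq> T" "\<And>j. Ck_on k (\<lambda>x. G x $ j) S" "Ck_on k f T"
  shows "Ck_on k (\<lambda>x. f (G x)) S"
  using assms(4,5)
proof (induction k arbitrary: f)
  case 0
  have "continuous_on S G"
    using 0(1) by (auto intro: continuous_on_vec_lambda[of S "\<lambda>i x. G x $ i", simplified])
  then show ?case using continuous_on_compose2[OF _ _ assms(3)] 0 by simp
next
  case (Suc k)
  define G' where "G' x v = (\<chi> j. frechet_derivative (\<lambda>x. G x $ j) (at x) v)" for x v
  have G: "(G has_derivative G' x) (at x)" if "x \<in> S" for x
    unfolding has_derivative_componentwise_within[of G] Basis_vec_def G'_def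
    using Ck_on_Suc_has_derivative[OF assms(1) Suc.prems(1) that]
    by (auto simp: inner_axis)
  have f: "(f has_derivative frechet_derivative f (at y)) (at y)" if "y \<in> T" for y
    by (rule Ck_on_Suc_has_derivative[OF assms(2) Suc.prems(2) that])
  have chain: "((\<lambda>x. f (G x)) has_derivative (\<lambda>v. frechet_derivative f (at (G x)) (G' x v))) (at x)"
    if "x \<in> S" for x
    using has_derivative_compose[OF G f] that assms(3) by blast
  have expand: "frechet_derivative f (at (G x)) (G' x v) =
    (\<Sum>j\<in>UNIV. frechet_derivative f (at (G x)) (axis j 1) * frechet_derivative (\<lambda>x. G x $ j) (at x) v)"
    if "x \<in> S" for x v
  proof -
    have "linear (frechet_derivative f (at (G x)))"
      using f that assms(3) has_derivative_linear by blast
    from linear_eq_sum_axis[OF this, of "G' x v"]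
    show ?thesis by (simp add: G'_def mult.commute)
  qed
  have "Ck_on k (\<lambda>x. frechet_derivative f (at (G x)) (axis j 1)) S" for j
    using Suc.IH[OF Ck_on_SucD[OF Suc.prems(1)], of "\<lambda>y. frechet_derivative f (at y) (axis j 1)"]
      Suc.prems(2) by simp
  moreover have "Ck_on k (\<lambda>x. frechet_derivative (\<lambda>x. G x $ j) (at x) (axis i 1)) S" for i j
    using Suc.prems(1) by simp
  ultimately have "Ck_on k (\<lambda>x. \<Sum>j\<in>UNIV. frechet_derivative f (at (G x)) (axis j 1) *
      frechet_derivative (\<lambda>x. G x $ j) (at x) (axis i 1)) S" for i
    by (intro Ck_on_sum Ck_on_mult assms(1)) simp
  then have "Ck_on k (\<lambda>x. frechet_derivative f (at (G x)) (G' x (axis i 1))) S" for i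
    by (rule Ck_on_cong[OF assms(1), rotated]) (simp add: expand)
  with chain show ?case by (rule Ck_on_SucI[OF assms(1)])
qed

lemma Ck_on_local:
  assumes "\<And>x. x \<in> S \<Longrightarrow> \<exists>T. open T \<and> x \<in> T \<and> Ck_on k f T"
  shows "Ck_on k f S"
  using assms
proof (induction k arbitrary: f)
  case 0
  then have "continuous (at x within S) f" if "x \<in> S" for x
    using that by (metis Ck_on.simps(1) continuous_at_imp_continuous_at_within continuous_on_eq_continuous_at)
  then show ?case by (simp add: continuous_on_eq_continuous_within)
next
  case (Suc k)
  have "f differentiable (at x within S)" if "x \<in> S" for x
    using Suc.prems[OF that] Ck_on.simps(2) differentiable_at_withinI differentiable_on_eq_differentiable_at by blast
  then have "f differentiable_on S" by (simp add: differentiable_on_def)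
  moreover have "Ck_on k (\<lambda>x. frechet_derivative f (at x) (axis i 1)) S" for i
    by (rule Suc.IH) (use Suc.prems in auto)
  ultimately show ?case by simp
qed

lemma smooth_on_subset: "smooth_on f S \<Longrightarrow> T \<subseteq> S \<Longrightarrow> smooth_on f T"
  unfolding smooth_on_def using Ck_on_subset by blast

lemma smooth_on_cong: "smooth_on f S \<Longrightarrow> open S \<Longrightarrow> (\<And>y. y \<in> S \<Longrightarrow> f y = h y) \<Longrightarrow> smooth_on h S"
  unfolding smooth_on_def using Ck_on_cong by blast

lemma smooth_on_const: "smooth_on (\<lambda>x. c) S"
  unfolding smooth_on_def using Ck_on_const by blast

lemma smooth_on_component: "open S \<Longrightarrow> smooth_on (\<lambda>x. x $ i) S"
  unfolding smooth_on_def using Ck_on_component by blast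

lemma smooth_on_add: "open S \<Longrightarrow> smooth_on f S \<Longrightarrow> smooth_on h S \<Longrightarrow> smooth_on (\<lambda>x. f x + h x) S"
  unfolding smooth_on_def using Ck_on_add by blast

lemma smooth_on_mult: "open S \<Longrightarrow> smooth_on f S \<Longrightarrow> smooth_on h S \<Longrightarrow> smooth_on (\<lambda>x. f x * h x) S"
  unfolding smooth_on_def using Ck_on_mult by blast

lemma smooth_on_inverse:
  "open S \<Longrightarrow> smooth_on f S \<Longrightarrow> (\<And>x. x \<in> S \<Longrightarrow> f x \<noteq> 0) \<Longrightarrow> smooth_on (\<lambda>x. inverse (f x)) S"
  unfolding smooth_on_def using Ck_on_inverse by blast

lemma smooth_on_compose:
  fixes G :: "real^'m \<Rightarrow> real^'l"
  assumes "open S" "open T" "G ` S \<subseteq> T" "\<And>j. smooth_on (\<lambda>x. G x $ j) S" "smooth_on f T"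
  shows "smooth_on (\<lambda>x. f (G x)) S"
  unfolding smooth_on_def
proof
  fix k
  show "Ck_on k (\<lambda>x. f (G x)) S"
    by (rule Ck_on_compose[OF assms(1-3)]) (use assms in \<open>auto simp: smooth_on_def\<close>)
qed

lemma smooth_on_local:
  assumes "\<And>x. x \<in> S \<Longrightarrow> \<exists>T. open T \<and> x \<in> T \<and> smooth_on f T"
  shows "smooth_on f S"
  unfolding smooth_on_def
proof
  fix k
  show "Ck_on k f S"
    by (rule Ck_on_local) (use assms in \<open>auto simp: smooth_on_def\<close>)
qed

lemma smooth_on_partial:
  "smooth_on f S \<Longrightarrow> smooth_on (\<lambda>x. frechet_derivative f (at x) (axis i 1)) S"
  unfolding smooth_on_def using Ck_on.simps(2) by blast

lemma smooth_on_has_derivative: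
  "smooth_on f S \<Longrightarrow> open S \<Longrightarrow> x \<in> S \<Longrightarrow> (f has_derivative frechet_derivative f (at x)) (at x)"
  unfolding smooth_on_def using Ck_on_Suc_has_derivative by blast

lemma smooth_on_continuous: "smooth_on f S \<Longrightarrow> continuous_on S f"
  unfolding smooth_on_def using Ck_on.simps(1) by blast

subsection \<open>Bump functions\<close>

text \<open>The functions \<open>q(1/t) exp(-1/t)\<close>, extended by \<open>0\<close> to \<open>t \<le> 0\<close>; this family is closed under
  differentiation.\<close>

definition flat_exp :: "real poly \<Rightarrow> real \<Rightarrow> real" where
  "flat_exp q t = (if t > 0 then poly q (1 / t) * exp (- (1 / t)) else 0)"

lemma tendsto_poly_mult_exp_minus: "((\<lambda>y::real. poly q y * exp (- y)) \<longlongrightarrow> 0) at_top"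
proof -
  have "((\<lambda>y. \<Sum>i\<le>degree q. coeff q i * (y ^ i / exp y)) \<longlongrightarrow> (\<Sum>i\<le>degree q. coeff q i * 0)) at_top"
    by (intro tendsto_sum tendsto_mult tendsto_const tendsto_power_div_exp_0)
  then show ?thesis
    unfolding poly_altdef sum_distrib_right by (simp add: exp_minus divide_inverse mult_ac)
qed

lemma tendsto_flat_exp_0: "(flat_exp q \<longlongrightarrow> 0) (at 0)"
proof (rule filterlim_split_at)
  have "eventually (\<lambda>t. flat_exp q t = 0) (at_left (0::real))"
    by (auto simp: flat_exp_def eventually_at_filter)
  then show "(flat_exp q \<longlongrightarrow> 0) (at_left 0)"
    by (rule tendsto_eventually)
  have "((\<lambda>t. poly q (inverse t) * exp (- inverse t)) \<longlongrightarrow> 0) (at_right 0)"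
    by (rule filterlim_compose[OF tendsto_poly_mult_exp_minus filterlim_inverse_at_top_right])
  moreover have "eventually (\<lambda>t. poly q (inverse t) * exp (- inverse t) = flat_exp q t) (at_right (0::real))"
    by (auto simp: flat_exp_def eventually_at_filter inverse_eq_divide)
  ultimately show "(flat_exp q \<longlongrightarrow> 0) (at_right 0)"
    by (rule Lim_transform_eventually)
qed

lemma flat_exp_has_derivative:
  "(flat_exp q has_real_derivative flat_exp ([:0, 0, 1:] * (q - pderiv q)) t) (at t)"
proof -
  consider "t > 0" | "t < 0" | "t = 0" by linarith
  then show ?thesis
  proof cases
    case 1
    have "((\<lambda>t. poly q (1 / t) * exp (- (1 / t))) has_real_derivative
        flat_exp ([:0, 0, 1:] * (q - pderiv q)) t) (at t)"
      using 1 by (auto intro!: derivative_eq_intros DERIV_chain2[OF poly_DERIV]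
          simp: flat_exp_def field_simps power2_eq_square)
    then show ?thesis
      by (rule has_field_derivative_transform_within_open[of _ _ _ "{0<..}"])
        (use 1 in \<open>auto simp: flat_exp_def\<close>)
  next
    case 2
    have "((\<lambda>t. 0) has_real_derivative 0) (at t)" by simp
    then have "(flat_exp q has_real_derivative 0) (at t)"
      by (rule has_field_derivative_transform_within_open[of _ _ _ "{..<0}"])
        (use 2 in \<open>auto simp: flat_exp_def\<close>)
    then show ?thesis using 2 by (simp add: flat_exp_def)
  next
    case 3
    have "eventually (\<lambda>h. flat_exp ([:0, 1:] * q) h = (flat_exp q (0 + h) - flat_exp q 0) / h) (at (0::real))"
      by (auto simp: flat_exp_def eventually_at_filter)
    with tendsto_flat_exp_0 have "((\<lambda>h. (flat_exp q (0 + h) - flat_exp q 0) / h) \<longlongrightarrow> 0) (at 0)"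
      by (rule Lim_transform_eventually)
    then show ?thesis using 3 by (simp add: DERIV_def flat_exp_def)
  qed
qed

text \<open>The bump function is \<open>exp(-1/(s\<^sup>2 - |x - c|\<^sup>2))\<close>, normalised at \<open>c\<close>.\<close>

lemma smooth_bump:
  fixes c :: "real^'m"
  assumes "s > 0"
  obtains \<beta> where "smooth_on \<beta> UNIV" "\<beta> c = 1" "\<And>x. dist c x \<ge> s \<Longrightarrow> \<beta> x = 0"
proof -
  define u where "u x = s^2 - (x - c) \<bullet> (x - c)" for x :: "real^'m"
  \<comment> \<open>The polynomial must vary in the induction, as it changes under differentiation.\<close>
  have "Ck_on k (\<lambda>x. flat_exp q (u x)) UNIV" for k q
  proof (induction k arbitrary: q)
    case 0
    have "isCont (flat_exp q) t" for t
      using DERIV_isCont[OF flat_exp_has_derivative] .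
    then have "continuous_on UNIV (flat_exp q)" by (simp add: continuous_at_imp_continuous_on)
    then have "continuous_on UNIV (\<lambda>x. flat_exp q (u x))"
      by (rule continuous_on_compose2) (auto simp: u_def intro!: continuous_intros)
    then show ?case by simp
  next
    case (Suc k)
    let ?q' = "[:0, 0, 1:] * (q - pderiv q)"
    show ?case
    proof (rule Ck_on_SucI[where f' = "\<lambda>x v. flat_exp ?q' (u x) * (- 2 * ((x - c) \<bullet> v))"])
      fix x :: "real^'m"
      have "(u has_derivative (\<lambda>v. - 2 * ((x - c) \<bullet> v))) (at x)"
        unfolding u_def by (auto intro!: derivative_eq_intros simp: inner_commute)
      then show "((\<lambda>x. flat_exp q (u x)) has_derivative
          (\<lambda>v. flat_exp ?q' (u x) * (- 2 * ((x - c) \<bullet> v)))) (at x)"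
        by (rule has_derivative_compose[OF _ flat_exp_has_derivative[unfolded has_field_derivative_def]])
    next
      fix i
      have "Ck_on k (\<lambda>x. flat_exp ?q' (u x) * (- 2 * (x $ i + - c $ i))) UNIV"
        by (intro Ck_on_mult Ck_on_add Ck_on_const Ck_on_component Suc open_UNIV)
      then show "Ck_on k (\<lambda>x. flat_exp ?q' (u x) * (- 2 * ((x - c) \<bullet> axis i 1))) UNIV"
        by (simp add: inner_axis)
    qed simp
  qed
  then have "smooth_on (\<lambda>x. flat_exp 1 (u x)) UNIV" by (simp add: smooth_on_def)
  then have 1: "smooth_on (\<lambda>x. flat_exp 1 (u x) * inverse (flat_exp 1 (s^2))) UNIV"
    by (intro smooth_on_mult smooth_on_const) auto
  have 2: "flat_exp 1 (s^2) \<noteq> 0" using assms by (simp add: flat_exp_def)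
  have 3: "flat_exp 1 (u x) = 0" if "dist c x \<ge> s" for x
  proof -
    have "s^2 \<le> (dist c x)^2" using that assms by (intro power_mono) auto
    then have "u x \<le> 0" by (simp add: u_def dist_norm norm_minus_commute[of c] flip: power2_norm_eq_inner)
    then show ?thesis by (simp add: flat_exp_def)
  qed
  show ?thesis by (rule that[OF 1]) (use 2 3 in \<open>auto simp: u_def\<close>)
qed

subsection \<open>Hadamard's lemma\<close>

text \<open>Differentiation under the integral sign. The factor \<open>t ^ m\<close> makes the statement inductive:
  each derivative in \<open>x\<close> contributes one more \<open>t\<close>.\<close>

lemma smooth_on_ray_integral:
  fixes c :: "real^'m"
  assumes "smooth_on g (ball c r)"
  shows "smooth_on (\<lambda>x. integral {0..1} (\<lambda>t. t ^ m * g (c + t *\<^sub>R (x - c)))) (ball c r)"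
proof -
  have seg: "c + t *\<^sub>R (x - c) \<in> ball c r" if "x \<in> ball c r" "t \<in> {0..1}" for x t
  proof -
    have "t * norm (x - c) \<le> norm (x - c)" using that by (simp add: mult_left_le_one_le)
    then show ?thesis using that by (simp add: dist_norm norm_minus_commute)
  qed
  have cont: "continuous_on (ball c r \<times> {0..1}) (\<lambda>(x, t). t ^ m * h (c + t *\<^sub>R (x - c)))"
    if "continuous_on (ball c r) h" for h :: "real^'m \<Rightarrow> real" and m
  proof -
    have "continuous_on (ball c r \<times> {0..1}) (\<lambda>z. h (c + snd z *\<^sub>R (fst z - c)))"
      by (rule continuous_on_compose2[OF that]) (auto intro!: continuous_intros seg simp del: mem_ball)
    then show ?thesis by (auto simp: case_prod_beta intro!: continuous_intros)
  qed
  have "Ck_on k (\<lambda>x. integral {0..1} (\<lambda>t. t ^ m * g (c + t *\<^sub>R (x - c)))) (ball c r)" for k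
    using assms
  proof (induction k arbitrary: g m)
    case 0
    show ?case
      using integral_continuous_on_param[of "ball c r" 0 1 "\<lambda>x t. t ^ m * g (c + t *\<^sub>R (x - c))"]
        cont[OF smooth_on_continuous[OF 0]] by simp
  next
    case (Suc k)
    let ?g = "\<lambda>x. frechet_derivative g (at x)"
    have dg: "(g has_derivative ?g y) (at y)" if "y \<in> ball c r" for y
      using smooth_on_has_derivative[OF Suc.prems open_ball that] .
    have cg: "continuous_on (ball c r) (\<lambda>x. ?g x v)" for v
    proof -
      have "continuous_on (ball c r) (\<lambda>x. \<Sum>i\<in>UNIV. v $ i * ?g x (axis i 1))"
        by (intro continuous_intros smooth_on_continuous smooth_on_partial Suc.prems)
      moreover have "?g x v = (\<Sum>i\<in>UNIV. v $ i * ?g x (axis i 1))" if "x \<in> ball c r" for x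
        by (rule linear_eq_sum_axis) (use dg[OF that] has_derivative_linear in blast)
      ultimately show ?thesis by (subst continuous_on_cong[OF refl]) auto
    qed
    define fx where "fx x t = Blinfun (\<lambda>v. t ^ Suc m * ?g (c + t *\<^sub>R (x - c)) v)" for x t
    have fx: "blinfun_apply (fx x t) = (\<lambda>v. t ^ Suc m * ?g (c + t *\<^sub>R (x - c)) v)"
      if "x \<in> ball c r" "t \<in> {0..1}" for x t
      unfolding fx_def
      by (rule bounded_linear_Blinfun_apply, rule bounded_linear_const_mult,
          rule has_derivative_bounded_linear, rule dg, rule seg[OF that])
    have 1: "((\<lambda>x. t ^ m * g (c + t *\<^sub>R (x - c))) has_derivative blinfun_apply (fx x t)) (at x within ball c r)"
      if "x \<in> ball c r" "t \<in> cbox 0 1" for x t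
    proof -
      have t: "t \<in> {0..1}" using that by simp
      have "((\<lambda>x. c + t *\<^sub>R (x - c)) has_derivative (\<lambda>v. t *\<^sub>R v)) (at x within ball c r)"
        by (auto intro!: derivative_eq_intros)
      from has_derivative_compose[OF this dg[OF seg[OF that(1) t]]]
      have "((\<lambda>x. t ^ m * g (c + t *\<^sub>R (x - c))) has_derivative
         (\<lambda>v. t ^ m * ?g (c + t *\<^sub>R (x - c)) (t *\<^sub>R v))) (at x within ball c r)"
        by (rule has_derivative_mult_right)
      moreover have "linear (?g (c + t *\<^sub>R (x - c)))"
        using dg[OF seg[OF that(1) t]] has_derivative_linear by blast
      ultimately show ?thesis
        unfolding fx[OF that(1) t] by (simp add: linear_scale mult_ac)
    qed
    have 2: "continuous_on (ball c r \<times> cbox 0 1) (\<lambda>(x, t). fx x t)"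
    proof (rule continuous_on_blinfun_componentwise)
      fix v :: "real^'m"
      have "continuous_on (ball c r \<times> {0..1}) (\<lambda>(x, t). t ^ Suc m * ?g (c + t *\<^sub>R (x - c)) v)"
        by (rule cont[OF cg])
      then show "continuous_on (ball c r \<times> cbox 0 1) (\<lambda>z. blinfun_apply (case z of (x, t) \<Rightarrow> fx x t) v)"
        by (rule continuous_on_cong[THEN iffD1, rotated 2]) (auto simp: fx simp del: mem_ball)
    qed
    have int1: "(\<lambda>t. t ^ m * g (c + t *\<^sub>R (x - c))) integrable_on cbox 0 1" if "x \<in> ball c r" for x
    proof (rule integrable_continuous)
      have "continuous_on (cbox 0 1) (\<lambda>t. g (c + t *\<^sub>R (x - c)))"
        by (rule continuous_on_compose2[OF smooth_on_continuous[OF Suc.prems]])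
          (use seg[OF that] in \<open>auto intro!: continuous_intros simp del: mem_ball\<close>)
      then show "continuous_on (cbox 0 1) (\<lambda>t. t ^ m * g (c + t *\<^sub>R (x - c)))"
        by (intro continuous_intros)
    qed
    have int2: "fx x integrable_on cbox 0 1" if "x \<in> ball c r" for x
    proof (rule integrable_continuous)
      have "continuous_on (cbox 0 1) (\<lambda>t. (\<lambda>(x, t). fx x t) (x, t))"
        by (rule continuous_on_compose2[OF 2]) (use that in \<open>auto intro!: continuous_intros\<close>)
      then show "continuous_on (cbox 0 1) (fx x)" by simp
    qed
    show ?case
    proof (rule Ck_on_SucI[where f' = "\<lambda>x. blinfun_apply (integral (cbox 0 1) (fx x))"])
      fix x assume x: "x \<in> ball c r"
      have "((\<lambda>x. integral (cbox 0 1) (\<lambda>t. t ^ m * g (c + t *\<^sub>R (x - c)))) has_derivative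
        blinfun_apply (integral (cbox 0 1) (fx x))) (at x within ball c r)"
        by (rule leibniz_rule[OF 1 int1 2 x convex_ball])
      then show "((\<lambda>x. integral {0..1} (\<lambda>t. t ^ m * g (c + t *\<^sub>R (x - c)))) has_derivative
        blinfun_apply (integral (cbox 0 1) (fx x))) (at x)"
        using x by (simp add: at_within_open[OF x open_ball])
    next
      fix i
      have "Ck_on k (\<lambda>x. integral {0..1} (\<lambda>t. t ^ Suc m * ?g (c + t *\<^sub>R (x - c)) (axis i 1))) (ball c r)"
        by (rule Suc.IH[OF smooth_on_partial[OF Suc.prems]])
      then show "Ck_on k (\<lambda>x. blinfun_apply (integral (cbox 0 1) (fx x)) (axis i 1)) (ball c r)"
      proof (rule Ck_on_cong[OF open_ball, rotated])
        fix x assume x: "x \<in> ball c r"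
        have "blinfun_apply (integral (cbox 0 1) (fx x)) (axis i 1)
           = integral (cbox 0 1) (\<lambda>t. blinfun_apply (fx x t) (axis i 1))"
          by (rule blinfun_apply_integral[OF int2[OF x]])
        then show "integral {0..1} (\<lambda>t. t ^ Suc m * ?g (c + t *\<^sub>R (x - c)) (axis i 1))
           = blinfun_apply (integral (cbox 0 1) (fx x)) (axis i 1)"
          using fx[OF x] by (auto intro!: integral_cong)
      qed
    qed simp
  qed
  then show ?thesis by (simp add: smooth_on_def)
qed

lemma hadamard:
  fixes c :: "real^'m"
  assumes "smooth_on f (ball c r)" "r > 0"
  obtains H where "\<And>i. smooth_on (H i) (ball c r)"
    "\<And>i. H i c = frechet_derivative f (at c) (axis i 1)"
    "\<And>x. x \<in> ball c r \<Longrightarrow> f x = f c + (\<Sum>i\<in>UNIV. (x $ i - c $ i) * H i x)"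
proof -
  define H where "H i x = integral {0..1} (\<lambda>t. t ^ 0 * frechet_derivative f (at (c + t *\<^sub>R (x - c))) (axis i 1))"
    for i x
  show ?thesis
  proof
    show "smooth_on (H i) (ball c r)" for i
      unfolding H_def by (rule smooth_on_ray_integral[OF smooth_on_partial[OF assms(1)]])
    show "H i c = frechet_derivative f (at c) (axis i 1)" for i
      by (simp add: H_def)
    fix x assume x: "x \<in> ball c r"
    have seg: "c + t *\<^sub>R (x - c) \<in> ball c r" if "t \<in> {0..1}" for t
    proof -
      have "t * norm (x - c) \<le> norm (x - c)" using that by (simp add: mult_left_le_one_le)
      then show ?thesis using that x by (simp add: dist_norm norm_minus_commute)
    qed
    let ?p = "\<lambda>i t. frechet_derivative f (at (c + t *\<^sub>R (x - c))) (axis i 1)"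
    have "((\<lambda>t. f (c + t *\<^sub>R (x - c))) has_vector_derivative (\<Sum>i\<in>UNIV. (x $ i - c $ i) * ?p i t)) (at t within {0..1})"
      if "t \<in> {0..1}" for t
    proof -
      note d = smooth_on_has_derivative[OF assms(1) open_ball seg[OF that]]
      let ?L = "frechet_derivative f (at (c + t *\<^sub>R (x - c)))"
      have lin: "linear ?L" using d has_derivative_linear by blast
      have "((\<lambda>t. c + t *\<^sub>R (x - c)) has_derivative (\<lambda>h. h *\<^sub>R (x - c))) (at t within {0..1})"
        by (auto intro!: derivative_eq_intros)
      from has_derivative_compose[OF this d]
      have "((\<lambda>t. f (c + t *\<^sub>R (x - c))) has_vector_derivative ?L (x - c)) (at t within {0..1})"
        by (simp add: has_vector_derivative_def linear_scale[OF lin])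
      then show ?thesis
        unfolding linear_eq_sum_axis[OF lin, of "x - c"] by simp
    qed
    from fundamental_theorem_of_calculus[OF zero_le_one this]
    have "((\<lambda>t. \<Sum>i\<in>UNIV. (x $ i - c $ i) * ?p i t) has_integral f x - f c) {0..1}" by simp
    moreover have "((\<lambda>t. \<Sum>i\<in>UNIV. (x $ i - c $ i) * ?p i t) has_integral
        (\<Sum>i\<in>UNIV. (x $ i - c $ i) * H i x)) {0..1}"
    proof (rule has_integral_sum, simp, rule has_integral_mult_right)
      fix i
      have "continuous_on {0..1} (?p i)"
        by (rule continuous_on_compose2[OF smooth_on_continuous[OF smooth_on_partial[OF assms(1)]]])
          (use seg in \<open>auto intro!: continuous_intros simp del: mem_ball\<close>)
      then show "(?p i has_integral H i x) {0..1}"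
        unfolding H_def by (simp add: integrable_continuous_interval integrable_integral)
    qed
    ultimately have "f x - f c = (\<Sum>i\<in>UNIV. (x $ i - c $ i) * H i x)"
      by (rule has_integral_unique)
    then show "f x = f c + (\<Sum>i\<in>UNIV. (x $ i - c $ i) * H i x)" by linarith
  qed
qed

section \<open>Smooth functions and tangent vectors on a manifold\<close>

lemma Cinf_const: "(\<lambda>q. c) \<in> Cinf A"
  by (auto simp: Cinf_def intro: smooth_on_const)

text \<open>A smooth manifold, given by an atlas \<open>A\<close>.\<close>

locale atlas =
  fixes A :: "('a::{t2_space,second_countable_topology}, 'm::finite) chart set"
  assumes atlas: "smooth_atlas A"
begin

lemma chart_cover: obtains U \<phi> where "(U, \<phi>) \<in> A" "p \<in> U"
  using atlas unfolding smooth_atlas_def by (metis (mono_tags, lifting) UNIV_I UN_E case_prod_conv surj_pair)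

lemma chart:
  assumes "(U, \<phi>) \<in> A"
  shows chart_open: "open U" and chart_image_open: "open (\<phi> ` U)"
    and chart_homeo: "homeomorphism U (\<phi> ` U) \<phi> (inv_into U \<phi>)"
  using atlas assms unfolding smooth_atlas_def by fastforce+

lemma chart_inv:
  assumes "(U, \<phi>) \<in> A"
  shows "q \<in> U \<Longrightarrow> inv_into U \<phi> (\<phi> q) = q" "x \<in> \<phi> ` U \<Longrightarrow> inv_into U \<phi> x \<in> U"
    "x \<in> \<phi> ` U \<Longrightarrow> \<phi> (inv_into U \<phi> x) = x"
  using chart_homeo[OF assms] by (auto simp: homeomorphism_def inv_into_into f_inv_into_f)

lemma chart_image_open_subset:
  assumes "(U, \<phi>) \<in> A" "open W" "W \<subseteq> U"
  shows "open (\<phi> ` W)"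
proof -
  have "openin (top_of_set (\<phi> ` U)) (\<phi> ` W)"
    using homeomorphism_imp_open_map[OF chart_homeo[OF assms(1)]] assms
    by (simp add: open_subset)
  then show ?thesis using chart_image_open[OF assms(1)] openin_open_eq by blast
qed

lemma transition_smooth:
  assumes "(U, \<phi>) \<in> A" "(V, \<psi>) \<in> A"
  shows "smooth_on (\<lambda>x. \<psi> (inv_into U \<phi> x) $ i) (\<phi> ` (U \<inter> V))"
  using atlas assms unfolding smooth_atlas_def by fast

lemma Cinf_smooth: "f \<in> Cinf A \<Longrightarrow> (U, \<phi>) \<in> A \<Longrightarrow> smooth_on (\<lambda>x. f (inv_into U \<phi> x)) (\<phi> ` U)"
  by (auto simp: Cinf_def)

lemma CinfI: "(\<And>U \<phi>. (U, \<phi>) \<in> A \<Longrightarrow> smooth_on (\<lambda>x. f (inv_into U \<phi> x)) (\<phi> ` U)) \<Longrightarrow> f \<in> Cinf A"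
  by (auto simp: Cinf_def)

lemma Cinf_add: "f \<in> Cinf A \<Longrightarrow> h \<in> Cinf A \<Longrightarrow> (\<lambda>q. f q + h q) \<in> Cinf A"
  by (rule CinfI, rule smooth_on_add[OF chart_image_open]) (auto intro: Cinf_smooth)

lemma Cinf_mult: "f \<in> Cinf A \<Longrightarrow> h \<in> Cinf A \<Longrightarrow> (\<lambda>q. f q * h q) \<in> Cinf A"
  by (rule CinfI, rule smooth_on_mult[OF chart_image_open]) (auto intro: Cinf_smooth)

lemma Cinf_diff: "f \<in> Cinf A \<Longrightarrow> h \<in> Cinf A \<Longrightarrow> (\<lambda>q. f q - h q) \<in> Cinf A"
  using Cinf_add[OF _ Cinf_mult[OF Cinf_const[of "- 1"]], of f h] by simp

lemma Cinf_sum: "finite I \<Longrightarrow> (\<And>i. i \<in> I \<Longrightarrow> f i \<in> Cinf A) \<Longrightarrow> (\<lambda>q. \<Sum>i\<in>I. f i q) \<in> Cinf A"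
  by (induction I rule: finite_induct) (auto intro: Cinf_const Cinf_add)

text \<open>Smoothness of a function that is locally a quotient of smooth functions. It is used for the
  Lee form, where only products \<open>\<theta>(Z) h\<close> are visibly smooth.\<close>

lemma Cinf_local_quotient:
  assumes "\<And>p. \<exists>h\<in>Cinf A. h p \<noteq> 0 \<and> (\<lambda>q. f q * h q) \<in> Cinf A"
  shows "f \<in> Cinf A"
proof (rule CinfI, rule smooth_on_local)
  fix U \<phi> x assume U: "(U, \<phi>) \<in> A" and x: "x \<in> \<phi> ` U"
  let ?inv = "inv_into U \<phi>"
  obtain h where h: "h \<in> Cinf A" "h (?inv x) \<noteq> 0" "(\<lambda>q. f q * h q) \<in> Cinf A"
    using assms by blast
  define T where "T = \<phi> ` U \<inter> (\<lambda>y. h (?inv y)) -` (- {0})"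
  have T: "open T" unfolding T_def
    by (rule continuous_open_preimage[OF smooth_on_continuous[OF Cinf_smooth[OF h(1) U]] chart_image_open[OF U]]) auto
  have "smooth_on (\<lambda>y. (f (?inv y) * h (?inv y)) * inverse (h (?inv y))) T"
    by (intro smooth_on_mult smooth_on_inverse smooth_on_subset[OF Cinf_smooth[OF h(3) U]]
        smooth_on_subset[OF Cinf_smooth[OF h(1) U]] T) (auto simp: T_def)
  then have "smooth_on (\<lambda>y. f (?inv y)) T"
    by (rule smooth_on_cong[OF _ T]) (auto simp: T_def)
  with T show "\<exists>T. open T \<and> x \<in> T \<and> smooth_on (\<lambda>y. f (?inv y)) T"
    using x h(2) by (auto simp: T_def intro!: exI[of _ T])
qed

text \<open>A smooth function in a chart with compact support extends by \<open>0\<close> to the manifold; this uses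
  that compact sets are closed, i.e. the Hausdorff property.\<close>

lemma chart_function_extension:
  assumes U: "(U, \<phi>) \<in> A" and F: "smooth_on F (\<phi> ` U)"
    and K: "compact K" "K \<subseteq> \<phi> ` U" "\<And>x. x \<in> \<phi> ` U \<Longrightarrow> x \<notin> K \<Longrightarrow> F x = 0"
  shows "(\<lambda>q. if q \<in> U then F (\<phi> q) else 0) \<in> Cinf A" (is "?f \<in> _")
proof (rule CinfI, rule smooth_on_local)
  fix V \<psi> y assume V: "(V, \<psi>) \<in> A" and y: "y \<in> \<psi> ` V"
  let ?inv = "inv_into V \<psi>"
  show "\<exists>T. open T \<and> y \<in> T \<and> smooth_on (\<lambda>y. ?f (?inv y)) T"
  proof (cases "?inv y \<in> U")
    case True
    let ?T = "\<psi> ` (V \<inter> U)"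
    have T: "open ?T"
      by (rule chart_image_open_subset[OF V]) (auto intro: chart_open[OF U] chart_open[OF V])
    have inU: "?inv x \<in> U" if "x \<in> ?T" for x
      using that chart_inv(1)[OF V] by auto
    have "smooth_on (\<lambda>x. F (\<phi> (?inv x))) ?T"
      by (rule smooth_on_compose[OF T chart_image_open[OF U] _ transition_smooth[OF V U] F])
        (use inU in auto)
    then have "smooth_on (\<lambda>y. ?f (?inv y)) ?T"
      by (rule smooth_on_cong[OF _ T]) (simp only: inU if_True)
    moreover have "y \<in> ?T" using True y chart_inv[OF V] by (metis IntI imageI)
    ultimately show ?thesis using T by blast
  next
    case False
    let ?K = "inv_into U \<phi> ` K"
    have "compact ?K"
      using K(1,2) chart_homeo[OF U] compact_continuous_image continuous_on_subset
      unfolding homeomorphism_def by metis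
    then have "closed ?K" by (rule compact_imp_closed)
    let ?T = "\<psi> ` (V - ?K)"
    have T: "open ?T"
      by (rule chart_image_open_subset[OF V]) (auto simp: chart_open[OF V] open_Diff \<open>closed ?K\<close>)
    have "?f (?inv x) = 0" if "x \<in> ?T" for x
    proof -
      have "?inv x \<notin> ?K" using that chart_inv(1)[OF V] by auto
      then show ?thesis using K(3) chart_inv(1)[OF U] by (metis imageI)
    qed
    then have "smooth_on (\<lambda>y. ?f (?inv y)) ?T"
      by (intro smooth_on_cong[OF smooth_on_const[of 0] T]) simp
    moreover have "?inv y \<notin> ?K"
    proof
      assume "?inv y \<in> ?K"
      then obtain x where "x \<in> K" "?inv y = inv_into U \<phi> x" by (rule imageE)
      then show False using False chart_inv(2)[OF U] K(2) by auto
    qed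
    then have "?inv y \<in> V - ?K" using y chart_inv(2)[OF V] by blast
    then have "y \<in> ?T" using imageI[of "?inv y" "V - ?K" \<psi>] chart_inv(3)[OF V y] by simp
    ultimately show ?thesis using T by blast
  qed
qed

end

lemma tangent_lin:
  "v \<in> tangent_space A p \<Longrightarrow> f \<in> Cinf A \<Longrightarrow> h \<in> Cinf A \<Longrightarrow>
    v (\<lambda>q. a * f q + b * h q) = a * v f + b * v h"
  by (simp add: tangent_space_def)

lemma tangent_mult:
  "v \<in> tangent_space A p \<Longrightarrow> f \<in> Cinf A \<Longrightarrow> h \<in> Cinf A \<Longrightarrow>
    v (\<lambda>q. f q * h q) = f p * v h + h p * v f"
  by (simp add: tangent_space_def)

lemma tangent_nonsmooth: "v \<in> tangent_space A p \<Longrightarrow> f \<notin> Cinf A \<Longrightarrow> v f = 0"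
  by (simp add: tangent_space_def)

lemma tangent_add:
  "v \<in> tangent_space A p \<Longrightarrow> f \<in> Cinf A \<Longrightarrow> h \<in> Cinf A \<Longrightarrow> v (\<lambda>q. f q + h q) = v f + v h"
  using tangent_lin[of v A p f h 1 1] by simp

lemma tangent_diff:
  "v \<in> tangent_space A p \<Longrightarrow> f \<in> Cinf A \<Longrightarrow> h \<in> Cinf A \<Longrightarrow> v (\<lambda>q. f q - h q) = v f - v h"
  using tangent_lin[of v A p f h 1 "- 1"] by simp

lemma tangent_cmult:
  "v \<in> tangent_space A p \<Longrightarrow> f \<in> Cinf A \<Longrightarrow> v (\<lambda>q. a * f q) = a * v f"
  using tangent_lin[of v A p f f a 0] by simp

lemma tangent_const:
  assumes "v \<in> tangent_space A p" shows "v (\<lambda>q. c) = 0"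
proof -
  have "v (\<lambda>q. 1) = 0"
    using tangent_mult[OF assms Cinf_const[of 1] Cinf_const[of 1]] by simp
  then show ?thesis using tangent_cmult[OF assms Cinf_const[of 1], of c] by simp
qed

lemma sum_tangent_apply: "(\<Sum>i\<in>I. c i *\<^sub>t e i) f = (\<Sum>i\<in>I. c i * e i f)"
  by (induction I rule: infinite_finite_induct) (auto simp: tscale_def)

context atlas
begin

lemma tangent_sum:
  assumes "v \<in> tangent_space A p" "finite I" "\<And>i. i \<in> I \<Longrightarrow> f i \<in> Cinf A"
  shows "v (\<lambda>q. \<Sum>i\<in>I. f i q) = (\<Sum>i\<in>I. v (f i))"
  using assms(2,3)
  by (induction I rule: finite_induct)
    (auto simp: tangent_const[OF assms(1)] tangent_add[OF assms(1)] Cinf_sum)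

subsection \<open>Coordinate frames\<close>

text \<open>The \<open>i\<close>-th partial derivative of \<open>f\<close> in the chart \<open>(U, \<phi>)\<close>, as a function of the coordinates.\<close>

definition partial :: "'a set \<Rightarrow> ('a \<Rightarrow> real^'m) \<Rightarrow> 'm \<Rightarrow> ('a \<Rightarrow> real) \<Rightarrow> real^'m \<Rightarrow> real" where
  "partial U \<phi> i f x = frechet_derivative (\<lambda>x. f (inv_into U \<phi> x)) (at x) (axis i 1)"

lemma partial_smooth:
  "(U, \<phi>) \<in> A \<Longrightarrow> f \<in> Cinf A \<Longrightarrow> smooth_on (partial U \<phi> i f) (\<phi> ` U)"
  unfolding partial_def[abs_def] by (intro smooth_on_partial Cinf_smooth)

lemma partial_eqI:
  "((\<lambda>x. f (inv_into U \<phi> x)) has_derivative L) (at x) \<Longrightarrow> partial U \<phi> i f x = L (axis i 1)"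
  unfolding partial_def by (metis frechet_derivative_at)

lemma Cinf_has_derivative:
  assumes "(U, \<phi>) \<in> A" "f \<in> Cinf A" "x \<in> \<phi> ` U"
  obtains L where "((\<lambda>x. f (inv_into U \<phi> x)) has_derivative L) (at x)"
    "\<And>i. L (axis i 1) = partial U \<phi> i f x"
  using smooth_on_has_derivative[OF Cinf_smooth[OF assms(2,1)] chart_image_open[OF assms(1)] assms(3)]
  by (metis partial_def)

lemma partial_lin:
  assumes "(U, \<phi>) \<in> A" "f \<in> Cinf A" "h \<in> Cinf A" "x \<in> \<phi> ` U"
  shows "partial U \<phi> i (\<lambda>q. a * f q + b * h q) x = a * partial U \<phi> i f x + b * partial U \<phi> i h x"
proof -
  obtain L M where L: "((\<lambda>x. f (inv_into U \<phi> x)) has_derivative L) (at x)" "\<And>i. L (axis i 1) = partial U \<phi> i f x"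
    and M: "((\<lambda>x. h (inv_into U \<phi> x)) has_derivative M) (at x)" "\<And>i. M (axis i 1) = partial U \<phi> i h x"
    using Cinf_has_derivative assms by metis
  from partial_eqI[of "\<lambda>q. a * f q + b * h q", OF has_derivative_add[OF has_derivative_mult_right[OF L(1)] has_derivative_mult_right[OF M(1)]]]
  show ?thesis by (simp add: L(2) M(2))
qed

lemma partial_mult:
  assumes "(U, \<phi>) \<in> A" "f \<in> Cinf A" "h \<in> Cinf A" "q \<in> U"
  shows "partial U \<phi> i (\<lambda>q. f q * h q) (\<phi> q) = f q * partial U \<phi> i h (\<phi> q) + h q * partial U \<phi> i f (\<phi> q)"
proof -
  obtain L M where L: "((\<lambda>x. f (inv_into U \<phi> x)) has_derivative L) (at (\<phi> q))" "\<And>i. L (axis i 1) = partial U \<phi> i f (\<phi> q)"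
    and M: "((\<lambda>x. h (inv_into U \<phi> x)) has_derivative M) (at (\<phi> q))" "\<And>i. M (axis i 1) = partial U \<phi> i h (\<phi> q)"
    using Cinf_has_derivative assms by (metis imageI)
  from partial_eqI[of "\<lambda>q. f q * h q", OF has_derivative_mult[OF L(1) M(1)]]
  show ?thesis by (simp add: L(2) M(2) chart_inv(1)[OF assms(1,4)])
qed

text \<open>Near every point the coordinate fields, cut off by a bump function, are global vector fields
  that form a basis: by Hadamard's lemma a derivation is determined by its values on the
  (cut off) coordinates.\<close>

theorem local_basis_exists: "\<exists>e. local_basis A p e"
proof -
  obtain U \<phi> where U: "(U, \<phi>) \<in> A" "p \<in> U" by (rule chart_cover)
  let ?inv = "inv_into U \<phi>"
  define c where "c = \<phi> p"
  have inv_c: "?inv c = p" using chart_inv(1)[OF U] by (simp add: c_def)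
  have cU: "c \<in> \<phi> ` U" using U by (simp add: c_def)
  obtain r where r: "r > 0" "ball c r \<subseteq> \<phi> ` U"
    using chart_image_open[OF U(1)] cU open_contains_ball by blast
  define s where "s = r / 2"
  have s: "s > 0" "s < r" using r by (auto simp: s_def)
  obtain \<beta> where \<beta>: "smooth_on \<beta> UNIV" "\<beta> c = 1" "\<And>x. dist c x \<ge> s \<Longrightarrow> \<beta> x = 0"
    using smooth_bump[OF s(1)] by blast
  have K: "compact (cball c s)" "cball c s \<subseteq> \<phi> ` U" "cball c s \<subseteq> ball c r"
    using r s by auto
  have extend: "(\<lambda>q. if q \<in> U then \<beta> (\<phi> q) * F (\<phi> q) else 0) \<in> Cinf A"
    if "smooth_on F (ball c r)" for F
  proof (rule chart_function_extension[OF U(1) _ K(1,2)])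
    show "smooth_on (\<lambda>x. \<beta> x * F x) (\<phi> ` U)"
    proof (rule smooth_on_local)
      fix x assume x: "x \<in> \<phi> ` U"
      show "\<exists>T. open T \<and> x \<in> T \<and> smooth_on (\<lambda>x. \<beta> x * F x) T"
      proof (cases "x \<in> ball c r")
        case True
        then show ?thesis using smooth_on_mult[OF open_ball smooth_on_subset[OF \<beta>(1) subset_UNIV] that]
          by blast
      next
        case False
        have "smooth_on (\<lambda>x. \<beta> x * F x) (- cball c s)"
          by (rule smooth_on_cong[OF smooth_on_const[of 0]]) (use \<beta>(3) in auto)
        then show ?thesis using False s by (intro exI[of _ "- cball c s"]) auto
      qed
    qed
  qed (use \<beta>(3) in auto)
  \<comment> \<open>The cut off coordinate fields; at \<open>p\<close> they are the coordinate derivations.\<close>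
  define E where "E i q f = (if f \<in> Cinf A then (if q \<in> U then \<beta> (\<phi> q) * partial U \<phi> i f (\<phi> q) else 0) else 0)"
    for i q f
  have E_tangent: "E i q \<in> tangent_space A q" for i q
    unfolding tangent_space_def
  proof (safe)
    fix f h a b assume fh: "f \<in> Cinf A" "h \<in> Cinf A"
    have "(\<lambda>q. a * f q + b * h q) \<in> Cinf A"
      using fh by (intro Cinf_add Cinf_mult Cinf_const)
    then show "E i q (\<lambda>q. a * f q + b * h q) = a * E i q f + b * E i q h"
      using fh partial_lin[OF U(1) fh] by (auto simp: E_def algebra_simps)
  next
    fix f h assume fh: "f \<in> Cinf A" "h \<in> Cinf A"
    then show "E i q (\<lambda>q. f q * h q) = f q * E i q h + h q * E i q f"
      using Cinf_mult[OF fh] partial_mult[OF U(1) fh] by (auto simp: E_def algebra_simps)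
  qed (simp add: E_def)
  have E_field: "E i \<in> vfields A" for i
    unfolding vfields_def
  proof (safe intro!: E_tangent)
    fix f assume "f \<in> Cinf A"
    with extend[OF smooth_on_subset[OF partial_smooth[OF U(1) this] r(2)]]
    show "(\<lambda>q. E i q f) \<in> Cinf A" by (simp add: E_def)
  qed
  \<comment> \<open>The cut off coordinates, normalised to vanish at \<open>p\<close>: they are dual to \<open>E\<close> at \<open>p\<close>.\<close>
  define X where "X j q = (if q \<in> U then \<beta> (\<phi> q) * (\<phi> q $ j + - c $ j) else 0)" for j q
  have X: "X j \<in> Cinf A" for j
    unfolding X_def[abs_def]
    by (rule extend) (intro smooth_on_add smooth_on_const smooth_on_component open_ball)
  have EX: "E i p (X j) = (if i = j then 1 else 0)" for i j
  proof -
    have "(\<beta> has_derivative frechet_derivative \<beta> (at c)) (at c)"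
      using smooth_on_has_derivative[OF \<beta>(1)] by simp
    moreover have "((\<lambda>x. x $ j + - c $ j) has_derivative (\<lambda>v. v $ j)) (at c)"
      using has_derivative_add[OF bounded_linear_imp_has_derivative[OF bounded_linear_vec_nth[of j]] has_derivative_const[of "- c $ j"]]
      by simp
    ultimately have "((\<lambda>x. \<beta> x * (x $ j + - c $ j)) has_derivative
        (\<lambda>v. \<beta> c * v $ j + frechet_derivative \<beta> (at c) v * (c $ j + - c $ j))) (at c)"
      by (rule has_derivative_mult)
    then have "((\<lambda>x. X j (?inv x)) has_derivative
        (\<lambda>v. \<beta> c * v $ j + frechet_derivative \<beta> (at c) v * (c $ j + - c $ j))) (at c)"
      by (rule has_derivative_transform_within_open[OF _ chart_image_open[OF U(1)] cU])
        (simp add: X_def chart_inv[OF U(1)])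
    from partial_eqI[OF this] show ?thesis
      using X U(2) by (simp add: E_def \<beta>(2) axis_def flip: c_def)
  qed
  have expand: "v = (\<Sum>i\<in>UNIV. v (X i) *\<^sub>t E i p)" if v: "v \<in> tangent_space A p" for v
  proof
    fix f
    show "v f = (\<Sum>i\<in>UNIV. v (X i) *\<^sub>t E i p) f"
    proof (cases "f \<in> Cinf A")
      case False
      then show ?thesis using tangent_nonsmooth[OF v] by (simp add: sum_tangent_apply E_def)
    next
      case f: True
      obtain H where H: "\<And>i. smooth_on (H i) (ball c r)"
        "\<And>i. H i c = partial U \<phi> i f c"
        "\<And>x. x \<in> ball c r \<Longrightarrow> f (?inv x) = f (?inv c) + (\<Sum>i\<in>UNIV. (x $ i - c $ i) * H i x)"
        by (rule hadamard[OF smooth_on_subset[OF Cinf_smooth[OF f U(1)] r(2)] r(1), folded partial_def[of U \<phi> _ f]])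
          (rule that)
      define h where "h i q = (if q \<in> U then \<beta> (\<phi> q) * H i (\<phi> q) else 0)" for i q
      have h: "h i \<in> Cinf A" for i
        unfolding h_def[abs_def] by (rule extend[OF H(1)])
      define b where "b q = (if q \<in> U then \<beta> (\<phi> q) * 1 else 0)" for q
      have b: "b \<in> Cinf A" unfolding b_def[abs_def] by (rule extend[OF smooth_on_const])
      have fp: "(\<lambda>q. f q - f p) \<in> Cinf A" by (intro Cinf_diff f Cinf_const)
      \<comment> \<open>Two factors of the bump function: one for each factor of the Hadamard expansion. At \<open>p\<close>,
        where \<open>b = 1\<close> and \<open>f - f p\<close> vanishes, the derivation does not notice them.\<close>
      have eq: "b q * b q * (f q - f p) = (\<Sum>i\<in>UNIV. X i q * h i q)" for q
      proof (cases "q \<in> U \<and> \<phi> q \<in> ball c r")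
        case True
        then have "f q - f p = (\<Sum>i\<in>UNIV. (\<phi> q $ i - c $ i) * H i (\<phi> q))"
          using H(3)[of "\<phi> q"] chart_inv(1)[OF U(1)] by (simp add: inv_c)
        then show ?thesis using True by (simp add: b_def X_def h_def sum_distrib_left mult_ac)
      next
        case False
        then have "b q = 0 \<and> (\<forall>i. X i q = 0)" using \<beta>(3)[of "\<phi> q"] s by (auto simp: b_def X_def)
        then show ?thesis by simp
      qed
      have "v f = v (\<lambda>q. f q - f p)"
        using tangent_diff[OF v f Cinf_const] tangent_const[OF v] by simp
      also have "\<dots> = v (\<lambda>q. b q * b q * (f q - f p))"
        using tangent_mult[OF v Cinf_mult[OF b b] fp] U(2) by (simp add: b_def \<beta>(2) flip: c_def)
      also have "\<dots> = v (\<lambda>q. \<Sum>i\<in>UNIV. X i q * h i q)" by (simp add: eq)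
      also have "\<dots> = (\<Sum>i\<in>UNIV. v (\<lambda>q. X i q * h i q))"
        by (rule tangent_sum[OF v finite]) (intro Cinf_mult X h)
      also have "\<dots> = (\<Sum>i\<in>UNIV. v (X i) * E i p f)"
      proof (rule sum.cong[OF refl])
        fix i
        have "X i p = 0" "h i p = E i p f"
          using U(2) f by (simp_all add: X_def h_def H(2) E_def \<beta>(2) flip: c_def)
        then show "v (\<lambda>q. X i q * h i q) = v (X i) * E i p f"
          using tangent_mult[OF v X h] by simp
      qed
      finally show ?thesis by (simp add: sum_tangent_apply)
    qed
  qed
  have "\<exists>!d::real^'m. v = (\<Sum>i\<in>UNIV. (d $ i) *\<^sub>t E i p)" if v: "v \<in> tangent_space A p" for v
  proof (rule ex1I[of _ "vec_lambda (\<lambda>i. v (X i))"])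
    show "v = (\<Sum>i\<in>UNIV. (vec_lambda (\<lambda>i. v (X i)) $ i) *\<^sub>t E i p)"
      using expand[OF v] by simp
    fix d :: "real^'m" assume d: "v = (\<Sum>i\<in>UNIV. (d $ i) *\<^sub>t E i p)"
    have "v (X j) = d $ j" for j
      unfolding d by (simp add: sum_tangent_apply EX if_distrib cong: if_cong)
    then show "d = vec_lambda (\<lambda>i. v (X i))" by (simp add: vec_eq_iff)
  qed
  then show ?thesis
    unfolding local_basis_def tangent_basis_def using E_field E_tangent by (intro exI[of _ E]) simp
qed

end

section \<open>Linear algebra in the tangent spaces\<close>

lemma tangent_zero: "0 \<in> tangent_space A p"
  by (simp add: tangent_space_def)

lemma tangent_scale: "u \<in> tangent_space A p \<Longrightarrow> a *\<^sub>t u \<in> tangent_space A p"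
  by (simp add: tangent_space_def tscale_def algebra_simps)

lemma tangent_plus: "u \<in> tangent_space A p \<Longrightarrow> v \<in> tangent_space A p \<Longrightarrow> u + v \<in> tangent_space A p"
  by (simp add: tangent_space_def algebra_simps)

lemma tangent_comb:
  "(\<And>i. i \<in> I \<Longrightarrow> e i \<in> tangent_space A p) \<Longrightarrow> (\<Sum>i\<in>I. c i *\<^sub>t e i) \<in> tangent_space A p"
  by (induction I rule: infinite_finite_induct) (auto intro: tangent_zero tangent_plus tangent_scale)

lemma tscale_one: "1 *\<^sub>t u = u" by (simp add: tscale_def)

lemma tscale_zero: "0 *\<^sub>t u = 0" by (simp add: tscale_def fun_eq_iff)

lemma tangent_basis_mem: "tangent_basis A p e \<Longrightarrow> e i \<in> tangent_space A p"
  by (simp add: tangent_basis_def)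

lemma tangent_basis_unique:
  fixes e :: "'m::finite \<Rightarrow> 'a tangent"
  assumes "tangent_basis A p e" "(\<Sum>i\<in>UNIV. c i *\<^sub>t e i) = (\<Sum>i\<in>UNIV. d i *\<^sub>t e i)"
  shows "c i = d i"
proof -
  let ?v = "\<Sum>i\<in>UNIV. c i *\<^sub>t e i"
  have "?v \<in> tangent_space A p" by (rule tangent_comb) (rule tangent_basis_mem[OF assms(1)])
  then have "\<exists>!x::real^'m. ?v = (\<Sum>i\<in>UNIV. (x $ i) *\<^sub>t e i)"
    using assms(1) by (simp add: tangent_basis_def)
  then have "vec_lambda c = vec_lambda d"
    by (rule ex1E) (metis (mono_tags, lifting) assms(2) sum.cong vec_lambda_beta)
  then show ?thesis by (simp add: vec_lambda_inject)
qed

lemma tangent_basis_expand: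
  assumes "tangent_basis A p e" "v \<in> tangent_space A p"
  obtains c where "v = (\<Sum>i\<in>UNIV. c i *\<^sub>t e i)"
  using assms unfolding tangent_basis_def by blast

lemma tangent_basis_expand_family:
  assumes "tangent_basis A p e" "\<And>j. v j \<in> tangent_space A p"
  obtains b where "\<And>j. v j = (\<Sum>i\<in>UNIV. b i j *\<^sub>t e i)"
proof -
  have "\<exists>c. v j = (\<Sum>i\<in>UNIV. c i *\<^sub>t e i)" for j
    by (rule tangent_basis_expand[OF assms(1) assms(2)[of j]]) blast
  then have "\<exists>c. \<forall>j. v j = (\<Sum>i\<in>UNIV. c j i *\<^sub>t e i)" by (intro choice) simp
  then obtain c where "\<And>j. v j = (\<Sum>i\<in>UNIV. c j i *\<^sub>t e i)" by (elim exE) simp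
  then show ?thesis by (intro that[of "\<lambda>i j. c j i"])
qed

lemma tangent_comb_delta: "(\<Sum>k\<in>UNIV. (if k = i then 1 else 0) *\<^sub>t e k) = e (i::'m::finite)"
  by (rule ext) (simp add: sum_tangent_apply mult_delta_left)

lemma tangent_comb_comb:
  assumes "finite I"
  shows "(\<Sum>i\<in>I. c i *\<^sub>t (\<Sum>k\<in>J. B k i *\<^sub>t e k)) = (\<Sum>k\<in>J. (\<Sum>i\<in>I. B k i * c i) *\<^sub>t e k)"
proof
  fix f
  have "(\<Sum>i\<in>I. c i *\<^sub>t (\<Sum>k\<in>J. B k i *\<^sub>t e k)) f = (\<Sum>i\<in>I. \<Sum>k\<in>J. c i * (B k i * e k f))"
    by (simp only: sum_tangent_apply sum_distrib_left)
  also have "\<dots> = (\<Sum>k\<in>J. \<Sum>i\<in>I. c i * (B k i * e k f))" by (rule sum.swap)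
  also have "\<dots> = (\<Sum>k\<in>J. (\<Sum>i\<in>I. B k i * c i) *\<^sub>t e k) f"
    by (simp only: sum_tangent_apply sum_distrib_right) (simp add: mult_ac)
  finally show "(\<Sum>i\<in>I. c i *\<^sub>t (\<Sum>k\<in>J. B k i *\<^sub>t e k)) f = (\<Sum>k\<in>J. (\<Sum>i\<in>I. B k i * c i) *\<^sub>t e k) f" .
qed

text \<open>A Riemannian almost product manifold; no condition on the trace of \<open>P\<close> yet.\<close>

locale almost_product =
  fixes A :: "('a::{t2_space,second_countable_topology}, 'm::finite) chart set"
    and P :: "'a endo" and g :: "'a metric"
  assumes almost_product: "riemannian_almost_product A P g"

sublocale almost_product \<subseteq> atlas
  using almost_product by unfold_locales (simp add: riemannian_almost_product_def)

context almost_product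
begin

abbreviation "T p \<equiv> tangent_space A p"
abbreviation "VF \<equiv> vfields A"
abbreviation "G \<equiv> metric_app g"
abbreviation "J \<equiv> endo_app P"

lemma g_lin: "u \<in> T p \<Longrightarrow> v \<in> T p \<Longrightarrow> w \<in> T p \<Longrightarrow> g p (a *\<^sub>t u + b *\<^sub>t v) w = a * g p u w + b * g p v w"
  and g_sym: "u \<in> T p \<Longrightarrow> v \<in> T p \<Longrightarrow> g p u v = g p v u"
  and g_pos: "v \<in> T p \<Longrightarrow> v \<noteq> 0 \<Longrightarrow> g p v v > 0"
  and P_tangent: "v \<in> T p \<Longrightarrow> P p v \<in> T p"
  and P_lin: "u \<in> T p \<Longrightarrow> v \<in> T p \<Longrightarrow> P p (a *\<^sub>t u + b *\<^sub>t v) = a *\<^sub>t P p u + b *\<^sub>t P p v"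
  and P_invol: "v \<in> T p \<Longrightarrow> P p (P p v) = v"
  and P_isometry: "u \<in> T p \<Longrightarrow> v \<in> T p \<Longrightarrow> g p (P p u) (P p v) = g p u v"
  using almost_product
  by (simp_all add: riemannian_almost_product_def riemannian_metric_def endo_field_def)

lemma g_plus: "u \<in> T p \<Longrightarrow> v \<in> T p \<Longrightarrow> w \<in> T p \<Longrightarrow> g p (u + v) w = g p u w + g p v w"
  using g_lin[of u p v w 1 1] by (simp add: tscale_one)

lemma g_scale: "u \<in> T p \<Longrightarrow> w \<in> T p \<Longrightarrow> g p (a *\<^sub>t u) w = a * g p u w"
  using g_lin[of u p u w a 0] by (simp add: tscale_zero)

lemma g_zero: "w \<in> T p \<Longrightarrow> g p 0 w = 0"
  using g_scale[OF tangent_zero, of w p 0] by (simp add: tscale_zero)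

lemma P_plus: "u \<in> T p \<Longrightarrow> v \<in> T p \<Longrightarrow> P p (u + v) = P p u + P p v"
  using P_lin[of u p v 1 1] by (simp add: tscale_one)

lemma P_scale: "u \<in> T p \<Longrightarrow> P p (a *\<^sub>t u) = a *\<^sub>t P p u"
  using P_lin[of u p u a 0] by (simp add: tscale_zero)

lemma P_zero: "P p 0 = 0"
  using P_scale[OF tangent_zero, of p 0] by (simp add: tscale_zero)

lemma g_comb:
  "finite I \<Longrightarrow> (\<And>i. i \<in> I \<Longrightarrow> e i \<in> T p) \<Longrightarrow> w \<in> T p \<Longrightarrow>
    g p (\<Sum>i\<in>I. c i *\<^sub>t e i) w = (\<Sum>i\<in>I. c i * g p (e i) w)"
  by (induction I rule: finite_induct) (simp_all add: g_zero g_plus g_scale tangent_scale tangent_comb)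

lemma P_comb:
  "finite I \<Longrightarrow> (\<And>i. i \<in> I \<Longrightarrow> e i \<in> T p) \<Longrightarrow>
    P p (\<Sum>i\<in>I. c i *\<^sub>t e i) = (\<Sum>i\<in>I. c i *\<^sub>t P p (e i))"
  by (induction I rule: finite_induct) (simp_all add: P_zero P_plus P_scale tangent_scale tangent_comb)

subsection \<open>The inverse Gram matrix of a basis\<close>

text \<open>The Gram matrix of a family of tangent vectors at \<open>p\<close>.\<close>

definition gram :: "'a \<Rightarrow> ('m \<Rightarrow> 'a tangent) \<Rightarrow> real^'m^'m" where
  "gram p e = (\<chi> i j. g p (e i) (e j))"

lemma gram_mult_vec:
  assumes "tangent_basis A p e"
  shows "(gram p e *v c) $ i = g p (e i) (\<Sum>j\<in>UNIV. (c $ j) *\<^sub>t e j)"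
proof -
  note e = tangent_basis_mem[OF assms]
  have "g p (e i) (\<Sum>j\<in>UNIV. (c $ j) *\<^sub>t e j) = g p (\<Sum>j\<in>UNIV. (c $ j) *\<^sub>t e j) (e i)"
    by (rule g_sym[OF e tangent_comb]) (rule e)
  also have "\<dots> = (\<Sum>j\<in>UNIV. c $ j * g p (e j) (e i))"
    by (rule g_comb[OF finite e e])
  finally show ?thesis by (simp add: matrix_vector_mult_def gram_def mult.commute g_sym[OF e e])
qed

lemma gram_inv_mult:
  assumes "tangent_basis A p e"
  shows "matrix_inv (gram p e) ** gram p e = mat 1"
proof -
  note e = tangent_basis_mem[OF assms]
  have "c = 0" if "gram p e *v c = 0" for c
  proof -
    let ?v = "\<Sum>j\<in>UNIV. (c $ j) *\<^sub>t e j"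
    have v: "?v \<in> T p" by (rule tangent_comb) (rule e)
    have "g p (e i) ?v = 0" for i
      using that gram_mult_vec[OF assms, of c i] by simp
    then have "g p ?v ?v = 0"
      using g_comb[OF finite e v, where c = "\<lambda>j. c $ j"] by simp
    then have "?v = 0" using g_pos[OF v] by fastforce
    also have "0 = (\<Sum>j\<in>UNIV. 0 *\<^sub>t e j)" by (simp add: tscale_zero)
    finally have "c $ j = 0" for j by (rule tangent_basis_unique[OF assms])
    then show "c = 0" by (simp add: vec_eq_iff)
  qed
  then have "\<exists>B. B ** gram p e = mat 1"
    using matrix_left_invertible_ker by blast
  then have "invertible (gram p e)"
    using matrix_left_right_inverse invertible_def by blast
  then show ?thesis unfolding invertible_def matrix_inv_def by (rule someI2_ex) simp
qed

text \<open>The functionals \<open>g\<^sup>i\<^sup>j g(e\<^sub>j,_)\<close> are the coordinates with respect to the basis; all contraction formulas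
  rest on this.\<close>

lemma basis_coordinate:
  assumes "tangent_basis A p e"
  shows "(\<Sum>j\<in>UNIV. matrix_inv (gram p e) $ i $ j * g p (e j) (\<Sum>k\<in>UNIV. c k *\<^sub>t e k)) = c i"
proof -
  let ?H = "matrix_inv (gram p e)"
  have "(\<Sum>j\<in>UNIV. ?H $ i $ j * g p (e j) (\<Sum>k\<in>UNIV. c k *\<^sub>t e k))
      = (?H *v (gram p e *v (vec_lambda c))) $ i"
    by (simp only: matrix_vector_mult_def[of ?H] vec_lambda_beta gram_mult_vec[OF assms])
  also have "\<dots> = c i" by (simp add: matrix_vector_mul_assoc gram_inv_mult[OF assms])
  finally show ?thesis .
qed

lemma gram_inv_contract:
  assumes "tangent_basis A p e" "u \<in> T p" "v \<in> T p"
  shows "(\<Sum>i\<in>UNIV. \<Sum>j\<in>UNIV. matrix_inv (gram p e) $ i $ j * (g p (e i) u * g p (e j) v)) = g p u v"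
proof -
  note e = tangent_basis_mem[OF assms(1)]
  obtain c where c: "v = (\<Sum>k\<in>UNIV. c k *\<^sub>t e k)"
    by (rule tangent_basis_expand[OF assms(1,3)])
  have "(\<Sum>i\<in>UNIV. \<Sum>j\<in>UNIV. matrix_inv (gram p e) $ i $ j * (g p (e i) u * g p (e j) v))
      = (\<Sum>i\<in>UNIV. g p (e i) u * (\<Sum>j\<in>UNIV. matrix_inv (gram p e) $ i $ j * g p (e j) v))"
    by (simp add: sum_distrib_left mult_ac)
  also have "\<dots> = (\<Sum>i\<in>UNIV. c i * g p (e i) u)"
    unfolding c basis_coordinate[OF assms(1)] by (simp add: mult.commute)
  also have "\<dots> = g p v u" unfolding c by (rule g_comb[symmetric, OF finite e assms(2)])
  finally show ?thesis using g_sym assms by simp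
qed

lemma gram_inv_trace:
  assumes "tangent_basis A p e" "\<And>j. P p (e j) = (\<Sum>i\<in>UNIV. M $ i $ j *\<^sub>t e i)"
  shows "(\<Sum>i\<in>UNIV. \<Sum>j\<in>UNIV. matrix_inv (gram p e) $ i $ j * g p (e i) (P p (e j))) = trace M"
proof -
  note e = tangent_basis_mem[OF assms(1)]
  have "g p (e i) (P p (e j)) = g p (e j) (P p (e i))" for i j
    using P_isometry[OF e P_tangent[OF e], of i j] P_invol[OF e] g_sym[OF e P_tangent[OF e]] by simp
  then have "(\<Sum>j\<in>UNIV. matrix_inv (gram p e) $ i $ j * g p (e i) (P p (e j))) = M $ i $ i" for i
    using basis_coordinate[OF assms(1), of i "\<lambda>k. M $ k $ i"] by (simp flip: assms(2))
  then show ?thesis by (simp add: trace_def)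
qed

lemma gram_inv_dim:
  assumes "tangent_basis A p e"
  shows "(\<Sum>i\<in>UNIV. \<Sum>j\<in>UNIV. matrix_inv (gram p e) $ i $ j * g p (e i) (e j)) = real CARD('m)"
proof -
  note e = tangent_basis_mem[OF assms(1)]
  have "(\<Sum>j\<in>UNIV. matrix_inv (gram p e) $ i $ j * g p (e j) (e i)) = 1" for i
    using basis_coordinate[OF assms, of i "\<lambda>k. if k = i then 1 else 0"]
    by (simp only: tangent_comb_delta) simp
  then show ?thesis using g_sym[OF e e] by simp
qed

lemma endo_matrix:
  assumes "tangent_basis A p e"
  obtains M :: "real^'m^'m" where "\<And>j. P p (e j) = (\<Sum>i\<in>UNIV. M $ i $ j *\<^sub>t e i)"
proof -
  obtain c where "\<And>j. P p (e j) = (\<Sum>i\<in>UNIV. c i j *\<^sub>t e i)"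
    by (rule tangent_basis_expand_family[OF assms, of "\<lambda>j. P p (e j)", OF P_tangent[OF tangent_basis_mem[OF assms]]]) (rule that)
  then show ?thesis using that[of "\<chi> i j. c i j"] by simp
qed

text \<open>The trace of \<open>P\<close> does not depend on the basis, so the definite description in
  \<^const>\<open>endo_trace\<close> denotes.\<close>

lemma trace_basis_independent:
  assumes e: "tangent_basis A p e" "\<And>j. P p (e j) = (\<Sum>i\<in>UNIV. M $ i $ j *\<^sub>t e i)"
    and e': "tangent_basis A p e'" "\<And>j. P p (e' j) = (\<Sum>i\<in>UNIV. M' $ i $ j *\<^sub>t e' i)"
  shows "trace M' = trace M"
proof -
  note m = tangent_basis_mem[OF e(1)] and m' = tangent_basis_mem[OF e'(1)]
  obtain b where b: "\<And>j. e' j = (\<Sum>i\<in>UNIV. b i j *\<^sub>t e i)"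
    by (rule tangent_basis_expand_family[OF e(1), of e', OF m']) (rule that)
  obtain c where c: "\<And>j. e j = (\<Sum>i\<in>UNIV. c i j *\<^sub>t e' i)"
    by (rule tangent_basis_expand_family[OF e'(1), of e, OF m]) (rule that)
  define B :: "real^'m^'m" where "B = (\<chi> i j. b i j)"
  define C :: "real^'m^'m" where "C = (\<chi> i j. c i j)"
  have "(\<Sum>k\<in>UNIV. (if k = j then 1 else 0) *\<^sub>t e k) = (\<Sum>k\<in>UNIV. (\<Sum>i\<in>UNIV. b k i * c i j) *\<^sub>t e k)" for j
  proof -
    have "e j = (\<Sum>i\<in>UNIV. c i j *\<^sub>t (\<Sum>k\<in>UNIV. b k i *\<^sub>t e k))" unfolding b[symmetric] by (rule c)
    then show ?thesis by (simp only: tangent_comb_comb[OF finite] tangent_comb_delta)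
  qed
  from tangent_basis_unique[OF e(1) this]
  have BC: "B ** C = mat 1"
    by (simp add: matrix_matrix_mult_def B_def C_def mat_def vec_eq_iff)
  have "(\<Sum>k\<in>UNIV. (\<Sum>i\<in>UNIV. b k i * M' $ i $ j) *\<^sub>t e k) = (\<Sum>k\<in>UNIV. (\<Sum>i\<in>UNIV. M $ k $ i * b i j) *\<^sub>t e k)" for j
  proof -
    have "P p (e' j) = (\<Sum>i\<in>UNIV. M' $ i $ j *\<^sub>t (\<Sum>k\<in>UNIV. b k i *\<^sub>t e k))" unfolding b[symmetric] by (rule e'(2))
    moreover have "P p (e' j) = (\<Sum>i\<in>UNIV. b i j *\<^sub>t (\<Sum>k\<in>UNIV. M $ k $ i *\<^sub>t e k))"
      unfolding b[of j] P_comb[OF finite m] e(2) ..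
    ultimately show ?thesis by (simp only: tangent_comb_comb[OF finite])
  qed
  from tangent_basis_unique[OF e(1) this]
  have BM: "B ** M' = M ** B"
    by (simp add: matrix_matrix_mult_def B_def vec_eq_iff)
  have "C ** B = mat 1" using BC matrix_left_right_inverse by blast
  then have "trace M' = trace (C ** (B ** M'))" by (simp add: matrix_mul_assoc)
  also have "\<dots> = trace ((M ** B) ** C)" unfolding BM by (rule trace_mul_sym)
  also have "\<dots> = trace (M ** (B ** C))" by (simp only: matrix_mul_assoc)
  finally show ?thesis by (simp add: BC)
qed

lemma endo_trace_eq:
  assumes "tangent_basis A p e" "\<And>j. P p (e j) = (\<Sum>i\<in>UNIV. M $ i $ j *\<^sub>t e i)"
  shows "endo_trace A P p = trace M"
  unfolding endo_trace_def
proof (rule the_equality)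
  fix t assume "\<exists>(e::'m \<Rightarrow> 'a tangent) (M::real^'m^'m). tangent_basis A p e \<and>
     (\<forall>j. P p (e j) = (\<Sum>i\<in>UNIV. (M $ i $ j) *\<^sub>t e i)) \<and> t = trace M"
  then obtain e' M' where "tangent_basis A p e'" "\<And>j. P p (e' j) = (\<Sum>i\<in>UNIV. (M' $ i $ j) *\<^sub>t e' i)"
      "t = trace M'" by blast
  then show "t = trace M" using trace_basis_independent[OF assms] by simp
qed (use assms in blast)

subsection \<open>Vector fields\<close>

lemma vf_tangent: "X \<in> VF \<Longrightarrow> X p \<in> T p"
  by (simp add: vfields_def)

lemma vf_plus: "X \<in> VF \<Longrightarrow> Y \<in> VF \<Longrightarrow> X + Y \<in> VF"
  by (simp add: vfields_def tangent_plus Cinf_add)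

lemma vf_scale: "X \<in> VF \<Longrightarrow> (\<lambda>p. c *\<^sub>t X p) \<in> VF"
  unfolding vfields_def by (auto intro: tangent_scale) (simp add: tscale_def Cinf_mult Cinf_const)

lemma vf_minus: assumes "X \<in> VF" "Y \<in> VF" shows "X - Y \<in> VF"
proof -
  have "X - Y = X + (\<lambda>p. (- 1) *\<^sub>t Y p)" by (intro ext) (simp add: tscale_def)
  then show ?thesis using vf_plus[OF assms(1) vf_scale[OF assms(2)]] by (simp only:)
qed

lemma vf_zero: "0 \<in> VF"
  by (simp add: vfields_def tangent_zero Cinf_const)

lemma vf_J: "X \<in> VF \<Longrightarrow> J X \<in> VF"
  using almost_product by (simp add: riemannian_almost_product_def endo_field_def)

lemma G_Cinf: "X \<in> VF \<Longrightarrow> Y \<in> VF \<Longrightarrow> G X Y \<in> Cinf A"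
  using almost_product by (simp add: riemannian_almost_product_def riemannian_metric_def)

lemma G_sym: "X \<in> VF \<Longrightarrow> Y \<in> VF \<Longrightarrow> G X Y = G Y X"
  by (simp add: metric_app_def fun_eq_iff g_sym vf_tangent)

lemma G_plus: "X \<in> VF \<Longrightarrow> Y \<in> VF \<Longrightarrow> Z \<in> VF \<Longrightarrow> G (X + Y) Z p = G X Z p + G Y Z p"
  by (simp add: metric_app_def g_plus vf_tangent)

lemma vf_sum: "finite I \<Longrightarrow> (\<And>i. i \<in> I \<Longrightarrow> W i \<in> VF) \<Longrightarrow> sum W I \<in> VF"
  by (induction I rule: finite_induct) (simp_all add: vf_zero vf_plus)

lemma G_sum:
  "finite I \<Longrightarrow> (\<And>i. i \<in> I \<Longrightarrow> W i \<in> VF) \<Longrightarrow> Z \<in> VF \<Longrightarrow> G (sum W I) Z p = (\<Sum>i\<in>I. G (W i) Z p)"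
proof (induction I rule: finite_induct)
  case empty
  then show ?case using g_zero[OF vf_tangent] by (simp add: metric_app_def zero_fun_def)
next
  case (insert i I)
  have "G (W i + sum W I) Z p = G (W i) Z p + G (sum W I) Z p"
    by (intro G_plus vf_sum insert) simp_all
  moreover have "G (sum W I) Z p = (\<Sum>i\<in>I. G (W i) Z p)"
    by (rule insert(3)) (use insert(4,5) in simp_all)
  ultimately show ?case by (simp only: sum.insert[OF insert(1,2)])
qed

lemma G_minus: "X \<in> VF \<Longrightarrow> Y \<in> VF \<Longrightarrow> Z \<in> VF \<Longrightarrow> G (X - Y) Z p = G X Z p - G Y Z p"
  using G_plus[OF vf_minus, of X Y Y Z p] by simp

lemma JJ: "X \<in> VF \<Longrightarrow> J (J X) = X"
  by (simp add: endo_app_def fun_eq_iff P_invol vf_tangent)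

lemma J_plus: "X \<in> VF \<Longrightarrow> Y \<in> VF \<Longrightarrow> J (X + Y) = J X + J Y"
  by (rule ext, rule ext) (simp add: endo_app_def P_plus vf_tangent)

lemma J_minus: "X \<in> VF \<Longrightarrow> Y \<in> VF \<Longrightarrow> J (X - Y) = J X - J Y"
  using J_plus[OF vf_minus, of X Y Y] by (simp add: algebra_simps)

lemma G_JJ: "X \<in> VF \<Longrightarrow> Y \<in> VF \<Longrightarrow> G (J X) (J Y) = G X Y"
  by (simp add: metric_app_def endo_app_def fun_eq_iff P_isometry vf_tangent)

lemma G_J: "X \<in> VF \<Longrightarrow> Y \<in> VF \<Longrightarrow> G (J X) Y = G X (J Y)"
  using G_JJ[of X "J Y"] by (simp add: vf_J JJ)

subsection \<open>Metric contraction\<close>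

text \<open>The contraction \<open>g\<^sup>i\<^sup>j S(e\<^sub>i,e\<^sub>j)\<close> at \<open>p\<close>, where \<open>S\<close> yields only the value at \<open>p\<close>. It equals
  \<^const>\<open>contr\<close>, which evaluates its argument at \<open>p\<close> only, and is easier to rewrite with.\<close>

definition ct :: "'a \<Rightarrow> ('a vfield \<Rightarrow> 'a vfield \<Rightarrow> real) \<Rightarrow> real" where
  "ct p S = contr A g (\<lambda>X Y q. S X Y) p"

lemma contr_eq_ct: "contr A g S p = ct p (\<lambda>X Y. S X Y p)"
  by (simp add: ct_def contr_def)

lemma ct_basis:
  obtains e where "local_basis A p e"
    "\<And>S. ct p S = (\<Sum>i\<in>UNIV. \<Sum>j\<in>UNIV. matrix_inv (gram p (\<lambda>i. e i p)) $ i $ j * S (e i) (e j))"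
proof -
  let ?e = "SOME e. local_basis A p e"
  have "local_basis A p ?e" using local_basis_exists by (rule someI_ex)
  then show ?thesis by (rule that) (simp add: ct_def contr_def Let_def gram_def metric_app_def)
qed

lemma ct_cong:
  assumes "\<And>X Y. X \<in> VF \<Longrightarrow> Y \<in> VF \<Longrightarrow> S X Y = S' X Y"
  shows "ct p S = ct p S'"
proof -
  obtain e where e: "local_basis A p e"
    "\<And>S. ct p S = (\<Sum>i\<in>UNIV. \<Sum>j\<in>UNIV. matrix_inv (gram p (\<lambda>i. e i p)) $ i $ j * S (e i) (e j))"
    using ct_basis by blast
  then have "e i \<in> VF" for i by (simp add: local_basis_def)
  then show ?thesis by (simp add: e(2) assms)
qed

lemma ct_add: "ct p (\<lambda>X Y. S X Y + S' X Y) = ct p S + ct p S'"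
  by (rule ct_basis[of p]) (simp add: distrib_left sum.distrib)

lemma ct_cmult: "ct p (\<lambda>X Y. c * S X Y) = c * ct p S"
  by (rule ct_basis[of p]) (simp add: sum_distrib_left mult_ac)

lemma ct_diff: "ct p (\<lambda>X Y. S X Y - S' X Y) = ct p S - ct p S'"
  using ct_add[of p S "\<lambda>X Y. (- 1) * S' X Y"] by (simp only: ct_cmult) simp

lemma ct_g: "ct p (\<lambda>X Y. G X Y p) = real CARD('m)"
  by (rule ct_basis[of p])
    (simp add: local_basis_def metric_app_def gram_inv_dim)

lemma ct_outer: "U \<in> VF \<Longrightarrow> V \<in> VF \<Longrightarrow> ct p (\<lambda>X Y. G X U p * G Y V p) = G U V p"
  by (rule ct_basis[of p])
    (simp add: local_basis_def metric_app_def gram_inv_contract vf_tangent)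

lemma ct_gJ: "endo_trace A P p = 0 \<Longrightarrow> ct p (\<lambda>X Y. G X (J Y) p) = 0"
proof -
  assume tr: "endo_trace A P p = 0"
  obtain e where e: "local_basis A p e"
    "\<And>S. ct p S = (\<Sum>i\<in>UNIV. \<Sum>j\<in>UNIV. matrix_inv (gram p (\<lambda>i. e i p)) $ i $ j * S (e i) (e j))"
    using ct_basis by blast
  then have b: "tangent_basis A p (\<lambda>i. e i p)" by (simp add: local_basis_def)
  obtain M :: "real^'m^'m" where M: "\<And>j. P p (e j p) = (\<Sum>i\<in>UNIV. M $ i $ j *\<^sub>t e i p)"
    using endo_matrix[OF b] by blast
  show ?thesis
    using gram_inv_trace[OF b M] endo_trace_eq[OF b M] tr
    by (simp add: e(2) metric_app_def endo_app_def)
qed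

text \<open>A contraction \<open>g\<^sup>i\<^sup>j \<Phi>(e\<^sub>i,e\<^sub>j)\<close> of a vector-valued \<open>\<Phi>\<close> at a point is the value of a global vector
  field.\<close>

lemma ct_vector:
  assumes "\<And>X Y. X \<in> VF \<Longrightarrow> Y \<in> VF \<Longrightarrow> \<Phi> X Y \<in> VF"
  obtains V where "V \<in> VF" "\<And>Z. Z \<in> VF \<Longrightarrow> ct p (\<lambda>X Y. G (\<Phi> X Y) Z p) = G V Z p"
proof -
  obtain e where e: "local_basis A p e"
    "\<And>S. ct p S = (\<Sum>i\<in>UNIV. \<Sum>j\<in>UNIV. matrix_inv (gram p (\<lambda>i. e i p)) $ i $ j * S (e i) (e j))"
    using ct_basis by blast
  then have eV: "e i \<in> VF" for i by (simp add: local_basis_def)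
  define H where "H k = matrix_inv (gram p (\<lambda>i. e i p)) $ fst k $ snd k" for k
  define W where "W k = (\<lambda>q. H k *\<^sub>t \<Phi> (e (fst k)) (e (snd k)) q)" for k
  have W: "W k \<in> VF" for k
    unfolding W_def by (rule vf_scale[OF assms[OF eV eV]])
  have GW: "G (W k) Z p = H k * G (\<Phi> (e (fst k)) (e (snd k))) Z p" if "Z \<in> VF" for Z k
    using g_scale[OF vf_tangent[OF assms[OF eV eV]] vf_tangent[OF that]]
    by (simp add: metric_app_def W_def)
  show ?thesis
  proof (rule that)
    show "sum W UNIV \<in> VF" by (rule vf_sum[OF finite W])
    fix Z assume Z: "Z \<in> VF"
    have "ct p (\<lambda>X Y. G (\<Phi> X Y) Z p) = (\<Sum>k\<in>UNIV. H k * G (\<Phi> (e (fst k)) (e (snd k))) Z p)"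
      by (simp add: e(2) H_def sum.cartesian_product case_prod_beta)
    then show "ct p (\<lambda>X Y. G (\<Phi> X Y) Z p) = G (sum W UNIV) Z p"
      by (simp only: G_sum[OF finite W Z] GW[OF Z])
  qed
qed

end

section \<open>Linear connections\<close>

context almost_product
begin

lemma conn_vf: "linear_connection A D \<Longrightarrow> X \<in> VF \<Longrightarrow> Y \<in> VF \<Longrightarrow> D X Y \<in> VF"
  by (simp add: linear_connection_def)

lemma conn_minus_right:
  assumes "linear_connection A D" "X \<in> VF" "Y \<in> VF" "Z \<in> VF"
  shows "D X (Y - Z) = D X Y - D X Z"
proof -
  have "D X ((Y - Z) + Z) = D X (Y - Z) + D X Z"
    using assms vf_minus[OF assms(3,4)] unfolding linear_connection_def by blast
  then show ?thesis by simp
qed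

lemma metric_conn:
  assumes "metric_connection A g D" "X \<in> VF" "Y \<in> VF" "Z \<in> VF"
  shows "X p (G Y Z) = G (D X Y) Z p + G Y (D X Z) p"
proof -
  have "cov_metric D g X Y Z p = 0" using assms by (simp add: metric_connection_def)
  then show ?thesis by (simp add: cov_metric_def act_def)
qed

section \<open>Contractions of the basic curvature-like tensors\<close>

lemma scal_ct: "scal A g L p = ct p (\<lambda>y z. ct p (\<lambda>u v. L u y z v p))"
  by (simp add: scal_def ricci_def contr_eq_ct)

lemma scal_star_ct: "scal_star A P g L p = ct p (\<lambda>y z. ct p (\<lambda>u v. L u y z (J v) p))"
  by (simp add: scal_star_def ricci_star_def contr_eq_ct)

text \<open>Only the values of the tensors at \<open>p\<close> on smooth vector fields matter.\<close>

lemma scal_add: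
  assumes "\<And>x y z w. x \<in> VF \<Longrightarrow> y \<in> VF \<Longrightarrow> z \<in> VF \<Longrightarrow> w \<in> VF \<Longrightarrow>
    L x y z w p = L1 x y z w p + L2 x y z w p"
  shows "scal A g L p = scal A g L1 p + scal A g L2 p"
    and "scal_star A P g L p = scal_star A P g L1 p + scal_star A P g L2 p"
proof -
  have "ct p (\<lambda>y z. ct p (\<lambda>u v. L u y z v p)) = ct p (\<lambda>y z. ct p (\<lambda>u v. L1 u y z v p + L2 u y z v p))"
    by (intro ct_cong assms)
  then show "scal A g L p = scal A g L1 p + scal A g L2 p" by (simp add: scal_ct ct_add)
  have "ct p (\<lambda>y z. ct p (\<lambda>u v. L u y z (J v) p))
      = ct p (\<lambda>y z. ct p (\<lambda>u v. L1 u y z (J v) p + L2 u y z (J v) p))"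
    by (intro ct_cong assms vf_J)
  then show "scal_star A P g L p = scal_star A P g L1 p + scal_star A P g L2 p"
    by (simp add: scal_star_ct ct_add)
qed

lemma pi_eq:
  "pi1 g x y z w p = G y z p * G x w p - G x z p * G y w p"
  "pi2 P g x y z w p = G y (J z) p * G x (J w) p - G x (J z) p * G y (J w) p"
  "pi3 P g x y z w p = G y z p * G x (J w) p - G x z p * G y (J w) p
     + G y (J z) p * G x w p - G x (J z) p * G y w p"
  by (simp_all add: pi1_def pi2_def pi3_def psi2_def psi1_def assoc_metric_def)

text \<open>With \<open>N = dim M\<close> and \<open>tr P = 0\<close>, the scalar curvatures of \<open>a \<pi>\<^sub>1 + b \<pi>\<^sub>3 + c \<pi>\<^sub>2\<close> are
  \<open>\<tau> = N ((N - 1) a - c)\<close> and \<open>\<tau>\<^sup>* = N (N - 2) b\<close>.\<close>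

lemma scal_pi_comb:
  assumes tr: "endo_trace A P p = 0"
    and L: "\<And>x y z w. x \<in> VF \<Longrightarrow> y \<in> VF \<Longrightarrow> z \<in> VF \<Longrightarrow> w \<in> VF \<Longrightarrow>
      L x y z w p = a * pi1 g x y z w p + b * pi3 P g x y z w p + c * pi2 P g x y z w p"
  shows "scal A g L p = real CARD('m) * ((real CARD('m) - 1) * a - c)"
    and "scal_star A P g L p = real CARD('m) * (real CARD('m) - 2) * b"
proof -
  let ?N = "real CARD('m)"
  have ric: "ct p (\<lambda>u v. L u y z v p) = ((?N - 1) * a - c) * G y z p + (?N - 2) * b * G y (J z) p"
    if "y \<in> VF" "z \<in> VF" for y z
  proof -
    have "ct p (\<lambda>u v. L u y z v p) = ct p (\<lambda>u v.
       (a * G y z p + b * G y (J z) p) * G u v p + (b * G y z p + c * G y (J z) p) * G u (J v) p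
       - (a * (G u z p * G v y p) + b * (G u z p * G v (J y) p + G u (J z) p * G v y p)
          + c * (G u (J z) p * G v (J y) p)))"
      by (rule ct_cong) (use that in \<open>simp add: L pi_eq G_sym[of _ y] G_sym[of _ "J y"] G_J vf_J algebra_simps\<close>)
    also have "\<dots> = (a * G y z p + b * G y (J z) p) * ?N + (b * G y z p + c * G y (J z) p) * 0
       - (a * G z y p + b * (G z (J y) p + G (J z) y p) + c * G (J z) (J y) p)"
      using that by (simp only: ct_add ct_diff ct_cmult ct_g ct_gJ[OF tr] ct_outer vf_J)
    also have "\<dots> = ((?N - 1) * a - c) * G y z p + (?N - 2) * b * G y (J z) p"
      using that by (simp add: vf_J G_J JJ G_sym[of z y] G_sym[of z "J y"] G_JJ algebra_simps)
    finally show ?thesis .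
  qed
  have "scal A g L p = ct p (\<lambda>y z. ((?N - 1) * a - c) * G y z p + (?N - 2) * b * G y (J z) p)"
    unfolding scal_ct by (rule ct_cong) (rule ric)
  then show "scal A g L p = ?N * ((?N - 1) * a - c)"
    by (simp add: ct_add ct_cmult ct_g ct_gJ[OF tr])
  have ric_star: "ct p (\<lambda>u v. L u y z (J v) p) = ((?N - 1) * c - a) * G y (J z) p + (?N - 2) * b * G y z p"
    if "y \<in> VF" "z \<in> VF" for y z
  proof -
    have "ct p (\<lambda>u v. L u y z (J v) p) = ct p (\<lambda>u v.
       (a * G y z p + b * G y (J z) p) * G u (J v) p + (b * G y z p + c * G y (J z) p) * G u v p
       - (a * (G u z p * G v (J y) p) + b * (G u z p * G v y p + G u (J z) p * G v (J y) p)
          + c * (G u (J z) p * G v y p)))"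
      by (rule ct_cong) (use that in \<open>simp add: L pi_eq G_sym[of _ y] G_sym[of _ "J y"] G_J JJ vf_J algebra_simps\<close>)
    also have "\<dots> = (a * G y z p + b * G y (J z) p) * 0 + (b * G y z p + c * G y (J z) p) * ?N
       - (a * G z (J y) p + b * (G z y p + G (J z) (J y) p) + c * G (J z) y p)"
      using that by (simp only: ct_add ct_diff ct_cmult ct_g ct_gJ[OF tr] ct_outer vf_J)
    also have "\<dots> = ((?N - 1) * c - a) * G y (J z) p + (?N - 2) * b * G y z p"
      using that by (simp add: vf_J G_J JJ G_sym[of z y] G_sym[of z "J y"] G_JJ algebra_simps)
    finally show ?thesis .
  qed
  have "scal_star A P g L p = ct p (\<lambda>y z. ((?N - 1) * c - a) * G y (J z) p + (?N - 2) * b * G y z p)"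
    unfolding scal_star_ct by (rule ct_cong) (rule ric_star)
  then show "scal_star A P g L p = ?N * (?N - 2) * b"
    by (simp add: ct_add ct_cmult ct_g ct_gJ[OF tr])
qed

end

section \<open>Natural connections with parallel torsion\<close>

text \<open>The data after the two classes have been merged by the sign \<open>\<delta>\<close>, and after the relation
  \<open>\<theta>(Px) = -\<delta> \<theta>(x)\<close> has been used to write the torsion with the symmetric form \<open>B\<close>. The torsion-free
  connection is \<open>D\<close>, the natural one \<open>D'\<close>.\<close>

locale parallel_natural = almost_product A P g
  for A :: "('a::{t2_space,second_countable_topology}, 'm::finite) chart set"
    and P :: "'a endo" and g :: "'a metric" +
  fixes n :: nat and D D' :: "'a connection" and \<delta> \<alpha> \<beta> :: real
    and \<theta> :: "'a vfield \<Rightarrow> 'a \<Rightarrow> real" and B :: "'a vfield \<Rightarrow> 'a vfield \<Rightarrow> 'a \<Rightarrow> real"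
  defines "\<theta> \<equiv> lee A D P g"
    and "B \<equiv> (\<lambda>x y p. \<alpha> * G x y p + \<beta> * G x (J y) p)"
  assumes tr: "endo_trace A P p = 0"
    and dim: "CARD('m) = 2 * n" and n: "n \<ge> 2"
    and lc: "levi_civita A g D"
    and lin': "linear_connection A D'"
    and met': "metric_connection A g D'"
    and J': "x \<in> VF \<Longrightarrow> y \<in> VF \<Longrightarrow> D' x (J y) = J (D' x y)"
    and \<delta>: "\<delta> = 1 \<or> \<delta> = - 1"
    and F: "x \<in> VF \<Longrightarrow> y \<in> VF \<Longrightarrow> z \<in> VF \<Longrightarrow> tensorF D P g x y z p =
      1 / (2 * real n) * ((G x y p + \<delta> * G x (J y) p) * \<theta> z p + (G x z p + \<delta> * G x (J z) p) * \<theta> y p)"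
    and \<theta>_J: "x \<in> VF \<Longrightarrow> \<theta> (J x) p = - \<delta> * \<theta> x p"
    and torsion: "x \<in> VF \<Longrightarrow> y \<in> VF \<Longrightarrow> z \<in> VF \<Longrightarrow>
      G (torsion D' x y) z p = \<theta> x p * B y z p - \<theta> y p * B x z p"
    and nondeg: "\<alpha> + \<delta> * \<beta> \<noteq> 0"
    and par: "parallel_torsion A D'"
begin

lemma lin: "linear_connection A D" and met: "metric_connection A g D"
  and torsion_free: "X \<in> VF \<Longrightarrow> Y \<in> VF \<Longrightarrow> torsion D X Y = 0"
  using lc by (simp_all add: levi_civita_def)

lemmas D_vf = conn_vf[OF lin] and D'_vf = conn_vf[OF lin']

lemma bracket_eq: "X \<in> VF \<Longrightarrow> Y \<in> VF \<Longrightarrow> bracket X Y = D X Y - D Y X"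
  using torsion_free[of X Y] by (simp add: torsion_def)

lemma bracket_vf: "X \<in> VF \<Longrightarrow> Y \<in> VF \<Longrightarrow> bracket X Y \<in> VF"
  by (simp only: bracket_eq vf_minus D_vf)

lemma torsion_vf: "X \<in> VF \<Longrightarrow> Y \<in> VF \<Longrightarrow> torsion D' X Y \<in> VF"
  unfolding torsion_def by (intro vf_minus D'_vf bracket_vf)

lemma G_minus_right: "X \<in> VF \<Longrightarrow> Y \<in> VF \<Longrightarrow> Z \<in> VF \<Longrightarrow> G Z (X - Y) p = G Z X p - G Z Y p"
  using G_minus[of X Y Z p] by (simp add: G_sym[of Z] vf_minus)

lemma B_sym: "X \<in> VF \<Longrightarrow> Y \<in> VF \<Longrightarrow> B X Y p = B Y X p"
  by (simp add: B_def G_sym[of X] G_J vf_J)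

lemma B_minus: "X \<in> VF \<Longrightarrow> Y \<in> VF \<Longrightarrow> Z \<in> VF \<Longrightarrow> B (X - Y) Z p = B X Z p - B Y Z p"
  by (simp add: B_def G_minus vf_J algebra_simps)

lemma B_Cinf: "X \<in> VF \<Longrightarrow> Y \<in> VF \<Longrightarrow> B X Y \<in> Cinf A"
  unfolding B_def by (intro Cinf_add Cinf_mult Cinf_const G_Cinf vf_J)

lemma B_deriv:
  assumes "W \<in> VF" "X \<in> VF" "Y \<in> VF"
  shows "W p (B X Y) = B (D' W X) Y p + B X (D' W Y) p"
proof -
  have "W p (B X Y) = \<alpha> * W p (G X Y) + \<beta> * W p (G X (J Y))"
    unfolding B_def by (rule tangent_lin[OF vf_tangent[OF assms(1)]]) (intro G_Cinf vf_J assms)+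
  then show ?thesis
    using assms by (simp add: metric_conn[OF met'] B_def vf_J J' algebra_simps)
qed

subsection \<open>The Lee form\<close>

lemma cov_endo_vf: "X \<in> VF \<Longrightarrow> Y \<in> VF \<Longrightarrow> cov_endo D P X Y \<in> VF"
  unfolding cov_endo_def by (intro vf_minus D_vf vf_J)

text \<open>At each point the Lee form is represented by a smooth vector field. The field depends on the
  point, which suffices for pointwise identities.\<close>

lemma lee_vector:
  obtains V where "V \<in> VF" "\<And>Z. Z \<in> VF \<Longrightarrow> \<theta> Z p = G Z V p"
proof -
  obtain V where V: "V \<in> VF"
    "\<And>Z. Z \<in> VF \<Longrightarrow> ct p (\<lambda>X Y. G (cov_endo D P X Y) Z p) = G V Z p"
    by (rule ct_vector[of "cov_endo D P" p]) (blast intro: cov_endo_vf that)+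
  then have "\<theta> Z p = G Z V p" if "Z \<in> VF" for Z
    using that by (simp add: \<theta>_def lee_def contr_eq_ct tensorF_def G_sym)
  with V(1) show ?thesis by (rule that)
qed

lemma \<theta>_minus: "X \<in> VF \<Longrightarrow> Y \<in> VF \<Longrightarrow> \<theta> (X - Y) p = \<theta> X p - \<theta> Y p"
  by (rule lee_vector[of p]) (simp add: G_minus vf_minus)

text \<open>The form \<open>g + \<delta> g(_,P _)\<close> has metric trace \<open>2n\<close>, hence is not \<open>0\<close>.\<close>

lemma exists_nonnull:
  obtains X where "X \<in> VF" "G X X p + \<delta> * G X (J X) p \<noteq> 0"
proof (rule ccontr)
  assume "\<not> thesis"
  with that have z: "G X X p + \<delta> * G X (J X) p = 0" if "X \<in> VF" for X using that by blast
  have "G X Y p + \<delta> * G X (J Y) p = 0" if X: "X \<in> VF" and Y: "Y \<in> VF" for X Y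
  proof -
    have 1: "G (X - Y) (X - Y) p = G X X p - 2 * G X Y p + G Y Y p"
      using X Y by (simp add: G_minus G_minus_right vf_minus G_sym[of Y X])
    have 2: "G (X - Y) (J (X - Y)) p = G X (J X) p - 2 * G X (J Y) p + G Y (J Y) p"
      using X Y G_sym[OF Y vf_J[OF X]] by (simp add: G_minus G_minus_right vf_minus vf_J J_minus G_J)
    have "(G X X p + \<delta> * G X (J X) p) + (G Y Y p + \<delta> * G Y (J Y) p) - 2 * (G X Y p + \<delta> * G X (J Y) p)
        = G (X - Y) (X - Y) p + \<delta> * G (X - Y) (J (X - Y)) p"
      unfolding 1 2 by (simp add: algebra_simps)
    then show ?thesis using z[OF X] z[OF Y] z[OF vf_minus[OF X Y]] by simp
  qed
  then have "ct p (\<lambda>X Y. G X Y p + \<delta> * G X (J Y) p) = ct p (\<lambda>X Y. 0 * G X Y p)"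
    by (intro ct_cong) simp
  then have "real CARD('m) = 0" by (simp only: ct_add ct_cmult ct_g ct_gJ[OF tr])
  then show False by simp
qed

text \<open>Smoothness of \<open>\<theta>(Z)\<close>, from the identity
  \<open>n (F(x,x,Z) - \<delta> F(x,x,PZ)) = \<theta>(Z) (g(x,x) + \<delta> g(x,Px))\<close>.\<close>

lemma \<theta>_Cinf:
  assumes Z: "Z \<in> VF" shows "\<theta> Z \<in> Cinf A"
proof (rule Cinf_local_quotient)
  fix p
  obtain X where X: "X \<in> VF" "G X X p + \<delta> * G X (J X) p \<noteq> 0" by (rule exists_nonnull)
  let ?h = "\<lambda>q. G X X q + \<delta> * G X (J X) q"
  have h: "?h \<in> Cinf A" using X by (intro Cinf_add Cinf_mult Cinf_const G_Cinf vf_J)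
  have "(\<lambda>q. real n * (tensorF D P g X X Z q - \<delta> * tensorF D P g X X (J Z) q)) \<in> Cinf A"
    unfolding tensorF_def using X Z by (intro Cinf_mult Cinf_diff Cinf_const G_Cinf cov_endo_vf vf_J)
  moreover have "real n * (tensorF D P g X X Z q - \<delta> * tensorF D P g X X (J Z) q) = \<theta> Z q * ?h q" for q
    using X Z n \<delta> by (auto simp: F vf_J JJ \<theta>_J field_simps)
  ultimately show "\<exists>h\<in>Cinf A. h p \<noteq> 0 \<and> (\<lambda>q. \<theta> Z q * h q) \<in> Cinf A"
    using h X(2) by (intro bexI[of _ ?h]) auto
qed

text \<open>The equation \<open>\<nabla>'T = 0\<close>, with \<open>T\<close> expressed through \<open>\<theta>\<close> and the parallel form \<open>B\<close>.\<close>

lemma lee_parallel_relation: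
  assumes W: "W \<in> VF" and X: "X \<in> VF" and Y: "Y \<in> VF" and Z: "Z \<in> VF"
  shows "(W p (\<theta> X) - \<theta> (D' W X) p) * B Y Z p = (W p (\<theta> Y) - \<theta> (D' W Y) p) * B X Z p"
proof -
  note v = D'_vf[OF W]
  have "cov_torsion D' W X Y = 0" using par W X Y by (simp add: parallel_torsion_def)
  then have eq: "D' W (torsion D' X Y) - torsion D' (D' W X) Y = torsion D' X (D' W Y)"
    by (simp add: cov_torsion_def)
  have "G (D' W (torsion D' X Y) - torsion D' (D' W X) Y) Z p = G (torsion D' X (D' W Y)) Z p"
    by (simp only: eq)
  then have 1: "G (D' W (torsion D' X Y)) Z p = \<theta> (D' W X) p * B Y Z p - \<theta> Y p * B (D' W X) Z p
      + (\<theta> X p * B (D' W Y) Z p - \<theta> (D' W Y) p * B X Z p)"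
    using W X Y Z by (simp add: G_minus torsion_vf v torsion)
  have fn: "G (torsion D' X Y) Z = (\<lambda>p. \<theta> X p * B Y Z p - \<theta> Y p * B X Z p)"
    by (rule ext) (rule torsion[OF X Y Z])
  have "W p (G (torsion D' X Y) Z) = W p (\<lambda>p. \<theta> X p * B Y Z p) - W p (\<lambda>p. \<theta> Y p * B X Z p)"
    unfolding fn by (rule tangent_diff[OF vf_tangent[OF W]]) (intro Cinf_mult \<theta>_Cinf B_Cinf X Y Z)+
  also have "\<dots> = (\<theta> X p * W p (B Y Z) + B Y Z p * W p (\<theta> X)) - (\<theta> Y p * W p (B X Z) + B X Z p * W p (\<theta> Y))"
    by (simp add: tangent_mult[OF vf_tangent[OF W]] \<theta>_Cinf B_Cinf X Y Z)
  finally have 2: "W p (G (torsion D' X Y) Z) = (\<theta> X p * W p (B Y Z) + B Y Z p * W p (\<theta> X))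
      - (\<theta> Y p * W p (B X Z) + B X Z p * W p (\<theta> Y))" .
  have 3: "W p (G (torsion D' X Y) Z) = G (D' W (torsion D' X Y)) Z p + (\<theta> X p * B Y (D' W Z) p - \<theta> Y p * B X (D' W Z) p)"
    using metric_conn[OF met' W torsion_vf[OF X Y] Z] torsion[OF X Y v[OF Z]] by simp
  show ?thesis
    using 1 2 3 by (simp add: B_deriv W X Y Z algebra_simps)
qed

lemma lee_parallel:
  assumes W: "W \<in> VF" and X: "X \<in> VF"
  shows "W p (\<theta> X) = \<theta> (D' W X) p"
proof (rule ccontr)
  assume ne: "W p (\<theta> X) \<noteq> \<theta> (D' W X) p"
  define \<eta> where "\<eta> Y = W p (\<theta> Y) - \<theta> (D' W Y) p" for Y
  have \<eta>: "\<eta> X \<noteq> 0" using ne by (simp add: \<eta>_def)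
  have r: "B Y Z p = \<eta> Y * (B X Z p / \<eta> X)" if "Y \<in> VF" "Z \<in> VF" for Y Z
    using lee_parallel_relation[OF W X that, of p] \<eta> by (simp add: \<eta>_def[symmetric] field_simps)
  define L where "L x y z w q = B y z q * B x w q - B x z q * B y w q" for x y z w q
  have L: "L x y z w p = \<alpha>\<^sup>2 * pi1 g x y z w p + \<alpha> * \<beta> * pi3 P g x y z w p + \<beta>\<^sup>2 * pi2 P g x y z w p" for x y z w
    by (simp add: L_def B_def pi_eq power2_eq_square algebra_simps)
  have L0: "L x y z w p = 0" if "x \<in> VF" "y \<in> VF" "z \<in> VF" "w \<in> VF" for x y z w
    unfolding L_def r[OF that(1,3)] r[OF that(2,3)] r[OF that(1,4)] r[OF that(2,4)] by simp
  have "scal A g L p = 0" "scal_star A P g L p = 0"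
    using scal_pi_comb[OF tr, of L p 0 0 0] L0 by simp_all
  moreover have "scal A g L p = real CARD('m) * ((real CARD('m) - 1) * \<alpha>\<^sup>2 - \<beta>\<^sup>2)"
    "scal_star A P g L p = real CARD('m) * (real CARD('m) - 2) * (\<alpha> * \<beta>)"
    by (rule scal_pi_comb[OF tr]; rule L)+
  ultimately have "real (2 * n) * ((real (2 * n) - 1) * \<alpha>\<^sup>2 - \<beta>\<^sup>2) = 0"
    "real (2 * n) * ((real (2 * n) - 2) * (\<alpha> * \<beta>)) = 0"
    by (simp_all only: dim mult.assoc)
  then have "(2 * real n - 1) * \<alpha>\<^sup>2 = \<beta>\<^sup>2" "\<alpha> * \<beta> = 0" using n by auto
  then have "\<alpha> = 0" "\<beta> = 0" using n by auto
  then show False using nondeg by simp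
qed

subsection \<open>The difference of the two connections\<close>

text \<open>The tensor by which the natural connection differs from the Levi-Civita connection.\<close>

definition Q :: "'a vfield \<Rightarrow> 'a vfield \<Rightarrow> 'a vfield" where
  "Q X Y = D' X Y - D X Y"

lemma Q_vf: "X \<in> VF \<Longrightarrow> Y \<in> VF \<Longrightarrow> Q X Y \<in> VF"
  unfolding Q_def by (intro vf_minus D_vf D'_vf)

text \<open>Both connections are metric, so \<open>Q\<close> is skew in its last two arguments and is determined by the
  torsion in the same way as the Levi-Civita connection by the Koszul formula.\<close>

lemma G_Q:
  assumes X: "X \<in> VF" and Y: "Y \<in> VF" and Z: "Z \<in> VF"
  shows "G (Q X Y) Z p = B X Y p * \<theta> Z p - B X Z p * \<theta> Y p"
proof -
  have skew: "G (Q x y) z p = - G (Q x z) y p" if "x \<in> VF" "y \<in> VF" "z \<in> VF" for x y z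
    using metric_conn[OF met' that, of p] metric_conn[OF met that, of p] that
    by (simp add: Q_def G_minus D_vf D'_vf G_sym[of y])
  have "torsion D' x y = Q x y - Q y x" if "x \<in> VF" "y \<in> VF" for x y
    using that by (simp add: torsion_def Q_def bracket_eq)
  then have T: "G (Q x y) z p - G (Q y x) z p = \<theta> x p * B y z p - \<theta> y p * B x z p"
    if "x \<in> VF" "y \<in> VF" "z \<in> VF" for x y z
    using torsion[OF that, of p] that by (simp add: G_minus Q_vf)
  show ?thesis
    using T[OF X Y Z] T[OF Y Z X] T[OF Z X Y] skew[OF X Y Z] skew[OF Y Z X] skew[OF Z X Y]
      B_sym[OF X Y, of p] B_sym[OF Y Z, of p] B_sym[OF Z X, of p]
    by (simp add: algebra_simps)
qed

lemma Q_parallel: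
  assumes W: "W \<in> VF" and X: "X \<in> VF" and Y: "Y \<in> VF" and Z: "Z \<in> VF"
  shows "G (D' W (Q X Y)) Z p = G (Q (D' W X) Y) Z p + G (Q X (D' W Y)) Z p"
proof -
  note v = D'_vf[OF W]
  have fn: "G (Q X Y) Z = (\<lambda>p. B X Y p * \<theta> Z p - B X Z p * \<theta> Y p)"
    by (rule ext) (rule G_Q[OF X Y Z])
  have "W p (G (Q X Y) Z) = W p (\<lambda>p. B X Y p * \<theta> Z p) - W p (\<lambda>p. B X Z p * \<theta> Y p)"
    unfolding fn by (rule tangent_diff[OF vf_tangent[OF W]]) (intro Cinf_mult \<theta>_Cinf B_Cinf X Y Z)+
  also have "\<dots> = (B X Y p * W p (\<theta> Z) + \<theta> Z p * W p (B X Y)) - (B X Z p * W p (\<theta> Y) + \<theta> Y p * W p (B X Z))"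
    by (simp add: tangent_mult[OF vf_tangent[OF W]] \<theta>_Cinf B_Cinf X Y Z)
  finally have "W p (G (Q X Y) Z) = (B X Y p * \<theta> (D' W Z) p + \<theta> Z p * (B (D' W X) Y p + B X (D' W Y) p))
      - (B X Z p * \<theta> (D' W Y) p + \<theta> Y p * (B (D' W X) Z p + B X (D' W Z) p))"
    by (simp only: lee_parallel[OF W] B_deriv[OF W] X Y Z)
  moreover have "W p (G (Q X Y) Z) = G (D' W (Q X Y)) Z p + G (Q X Y) (D' W Z) p"
    by (rule metric_conn[OF met' W Q_vf[OF X Y] Z])
  ultimately show ?thesis
    using X Y Z v by (simp add: G_Q algebra_simps)
qed

lemma curv_vf:
  assumes "linear_connection A C" "X \<in> VF" "Y \<in> VF" "Z \<in> VF"
  shows "curv C X Y Z \<in> VF"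
  unfolding curv_def using assms by (intro vf_minus conn_vf[OF assms(1)] bracket_vf)

text \<open>The derivatives of \<open>Q\<close> in \<open>[\<nabla>'\<^sub>x - Q\<^sub>x, \<nabla>'\<^sub>y - Q\<^sub>y]\<close> reduce, as \<open>Q\<close> is parallel for \<open>\<nabla>'\<close>, to \<open>Q\<close> applied to
  \<open>\<nabla>'\<^sub>x y - \<nabla>'\<^sub>y x\<close>, which together with \<open>Q([x,y],_)\<close> makes \<open>Q(T(x,y),_)\<close>.\<close>

lemma curv_difference:
  assumes X: "X \<in> VF" and Y: "Y \<in> VF" and Z: "Z \<in> VF" and W: "W \<in> VF"
  shows "curv4 D' g X Y Z W p = curv4 D g X Y Z W p + G (Q (torsion D' X Y) Z) W p
    - G (Q X (Q Y Z)) W p + G (Q Y (Q X Z)) W p"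
proof -
  have DD: "G (D x (D y z)) W p = G (D' x (D' y z)) W p - G (Q (D' x y) z) W p
      - G (Q y (D' x z)) W p - G (Q x (D' y z)) W p + G (Q x (Q y z)) W p"
    if x: "x \<in> VF" and y: "y \<in> VF" and z: "z \<in> VF" for x y z
  proof -
    have 1: "D u v = D' u v - Q u v" for u v by (simp add: Q_def)
    have "D x (D y z) = D' x (D y z) - Q x (D y z)" by (rule 1)
    also have "D' x (D y z) = D' x (D' y z) - D' x (Q y z)"
      unfolding 1[of y z] by (rule conn_minus_right[OF lin' x D'_vf[OF y z] Q_vf[OF y z]])
    finally have 2: "D x (D y z) = D' x (D' y z) - D' x (Q y z) - Q x (D y z)" .
    have "G (D x (D y z)) W p = G (D' x (D' y z)) W p - G (D' x (Q y z)) W p - G (Q x (D y z)) W p"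
      unfolding 2 by (simp only: G_minus vf_minus D_vf D'_vf Q_vf x y z W)
    moreover have "G (Q x (D y z)) W p = G (Q x (D' y z)) W p - G (Q x (Q y z)) W p"
    proof -
      have b: "B x (D y z) p = B x (D' y z) p - B x (Q y z) p"
        unfolding 1[of y z] using x y z by (simp add: B_sym[of x] B_minus vf_minus D'_vf Q_vf)
      have t: "\<theta> (D y z) p = \<theta> (D' y z) p - \<theta> (Q y z) p"
        unfolding 1[of y z] using x y z by (simp add: \<theta>_minus D'_vf Q_vf)
      have "G (Q x (D y z)) W p = (B x (D' y z) p - B x (Q y z) p) * \<theta> W p
          - B x W p * (\<theta> (D' y z) p - \<theta> (Q y z) p)"
        by (simp only: G_Q D_vf x y z W b t)
      then show ?thesis using x y z W by (simp add: G_Q D'_vf Q_vf algebra_simps)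
    qed
    ultimately show ?thesis using Q_parallel[OF x y z W, of p] by simp
  qed
  have br: "G (D (bracket X Y) Z) W p = G (D' (bracket X Y) Z) W p - G (Q (bracket X Y) Z) W p"
    using X Y Z W by (simp add: Q_def G_minus bracket_vf D_vf D'_vf)
  have to: "G (Q (torsion D' X Y) Z) W p = G (Q (D' X Y) Z) W p - G (Q (D' Y X) Z) W p - G (Q (bracket X Y) Z) W p"
  proof -
    have "B (torsion D' X Y) V p = B (D' X Y) V p - B (D' Y X) V p - B (bracket X Y) V p" if "V \<in> VF" for V
      unfolding torsion_def by (simp only: B_minus vf_minus D'_vf bracket_vf X Y that)
    then show ?thesis
      using X Y Z W by (simp add: G_Q torsion_vf D'_vf bracket_vf left_diff_distrib right_diff_distrib)
  qed
  have R: "curv4 C g X Y Z W p = G (C X (C Y Z)) W p - G (C Y (C X Z)) W p - G (C (bracket X Y) Z) W p"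
    if "linear_connection A C" for C
    using X Y Z W by (simp add: curv4_def curv_def G_minus vf_minus conn_vf[OF that] bracket_vf)
  show ?thesis
    unfolding R[OF lin] R[OF lin'] DD[OF X Y Z] DD[OF Y X Z] br to by simp
qed

lemma curv_J:
  assumes X: "X \<in> VF" and Y: "Y \<in> VF" and Z: "Z \<in> VF" and W: "W \<in> VF"
  shows "curv4 D' g X Y (J Z) (J W) p = curv4 D' g X Y Z W p"
proof -
  have "curv D' X Y (J Z) = J (curv D' X Y Z)"
    using X Y Z by (simp add: curv_def J' J_minus D'_vf bracket_vf vf_minus vf_J)
  then show ?thesis
    using G_JJ[OF curv_vf[OF lin' X Y Z] W] by (simp add: curv4_def)
qed

theorem curv_eq_K:
  obtains c where "\<And>X Y Z W. X \<in> VF \<Longrightarrow> Y \<in> VF \<Longrightarrow> Z \<in> VF \<Longrightarrow> W \<in> VF \<Longrightarrow>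
    curv4 D' g X Y Z W p = tensorK D P g X Y Z W p
      + c * (\<alpha>\<^sup>2 + \<beta>\<^sup>2) / 2 * (pi1 g X Y Z W p + pi2 P g X Y Z W p) + c * \<alpha> * \<beta> * pi3 P g X Y Z W p"
proof -
  obtain V where V: "V \<in> VF" "\<And>Z. Z \<in> VF \<Longrightarrow> \<theta> Z p = G Z V p" by (rule lee_vector[of p]) (rule that)
  define c where "c = \<theta> V p"
  define h where "h x y = G x y p + \<delta> * G x (J y) p" for x y
  define \<kappa> where "\<kappa> = \<beta> * (\<alpha> * \<delta> + \<beta>)"
  have BV: "B x V p = (\<alpha> - \<delta> * \<beta>) * \<theta> x p" if "x \<in> VF" for x
  proof -
    have "B x V p = \<alpha> * \<theta> x p + \<beta> * \<theta> (J x) p"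
      using V that by (simp add: B_def vf_J G_J)
    then show ?thesis using \<theta>_J[OF that, of p] by (simp add: algebra_simps)
  qed
  have BJ: "B x (J z) p = \<alpha> * G x (J z) p + \<beta> * G x z p" if "z \<in> VF" for x z
    using that by (simp add: B_def JJ)
  \<comment> \<open>In terms of the symmetric operator \<open>N\<close> of \<open>B\<close>, with eigenvalue \<open>\<nu> = \<alpha> - \<delta> \<beta>\<close> on the dual of \<open>\<theta>\<close>:
    \<open>N (N - \<nu>)\<close> vanishes on the \<open>-\<delta>\<close>-eigenspace of \<open>P\<close>, so it is a multiple of \<open>1 + \<delta> P\<close>.\<close>
  have key: "\<alpha> * B x z p + \<beta> * B x (J z) p - (\<alpha> - \<delta> * \<beta>) * B x z p = \<kappa> * h x z"
    if "z \<in> VF" for x z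
    using \<delta> that by (auto simp: JJ B_def h_def \<kappa>_def algebra_simps)
  have QT: "G (Q (torsion D' x y) z) w p =
      (\<theta> x p * (\<alpha> * B y z p + \<beta> * B y (J z) p) - \<theta> y p * (\<alpha> * B x z p + \<beta> * B x (J z) p)) * \<theta> w p
      - (\<theta> x p * (\<alpha> * B y w p + \<beta> * B y (J w) p) - \<theta> y p * (\<alpha> * B x w p + \<beta> * B x (J w) p)) * \<theta> z p"
    if "x \<in> VF" "y \<in> VF" "z \<in> VF" "w \<in> VF" for x y z w
  proof -
    have "B (torsion D' x y) v p = \<theta> x p * (\<alpha> * B y v p + \<beta> * B y (J v) p) - \<theta> y p * (\<alpha> * B x v p + \<beta> * B x (J v) p)"
      if v: "v \<in> VF" for v
    proof -
      have "B (torsion D' x y) v p = \<alpha> * G (torsion D' x y) v p + \<beta> * G (torsion D' x y) (J v) p"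
        by (simp only: B_def)
      then show ?thesis
        unfolding torsion[OF \<open>x \<in> VF\<close> \<open>y \<in> VF\<close> v] torsion[OF \<open>x \<in> VF\<close> \<open>y \<in> VF\<close> vf_J[OF v]]
        by (simp add: algebra_simps)
    qed
    then show ?thesis using that by (simp add: G_Q torsion_vf)
  qed
  have QQ: "G (Q x (Q y z)) w p =
      (B y z p * (\<alpha> - \<delta> * \<beta>) * \<theta> x p - \<theta> z p * (\<alpha> * B y x p + \<beta> * B y (J x) p)) * \<theta> w p
      - B x w p * (B y z p * c - (\<alpha> - \<delta> * \<beta>) * \<theta> y p * \<theta> z p)"
    if x: "x \<in> VF" and y: "y \<in> VF" and z: "z \<in> VF" and w: "w \<in> VF" for x y z w
  proof -
    have "B x (Q y z) p = \<alpha> * G (Q y z) x p + \<beta> * G (Q y z) (J x) p"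
      using x y z by (simp add: B_sym[of x] Q_vf) (simp add: B_def)
    then have 1: "B x (Q y z) p = B y z p * (\<alpha> - \<delta> * \<beta>) * \<theta> x p - \<theta> z p * (\<alpha> * B y x p + \<beta> * B y (J x) p)"
      using \<theta>_J[OF x, of p] x y z by (simp add: G_Q vf_J algebra_simps)
    have "\<theta> (Q y z) p = B y z p * c - (\<alpha> - \<delta> * \<beta>) * \<theta> y p * \<theta> z p"
      using V(1) V(2)[OF Q_vf[OF y z]] y z by (simp add: G_Q BV c_def)
    then show ?thesis using 1 x y z w by (simp add: G_Q Q_vf)
  qed
  have BJs: "B x (J y) p = B y (J x) p" if "x \<in> VF" "y \<in> VF" for x y
    using that by (simp add: BJ G_sym[of x] G_J vf_J)
  have diff: "curv4 D' g x y z w p - curv4 D g x y z w p = c * (B y z p * B x w p - B x z p * B y w p)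
      + \<kappa> * (\<theta> x p * \<theta> w p * h y z - \<theta> x p * \<theta> z p * h y w - \<theta> y p * \<theta> w p * h x z + \<theta> y p * \<theta> z p * h x w)"
    if x: "x \<in> VF" and y: "y \<in> VF" and z: "z \<in> VF" and w: "w \<in> VF" for x y z w
    unfolding curv_difference[OF x y z w] QT[OF x y z w] QQ[OF x y z w] QQ[OF y x z w]
      B_sym[OF y x] BJs[OF y x] right_diff_distrib distrib_left
    unfolding mult.left_commute[of \<kappa>] key[OF z, symmetric] key[OF w, symmetric]
    by (simp add: algebra_simps)
  have hJ: "h x (J z) = \<delta> * h x z" if "x \<in> VF" "z \<in> VF" for x z
    using \<delta> that by (auto simp: h_def JJ)
  show ?thesis
  proof (rule that[of c])
    fix X Y Z W assume v: "X \<in> VF" "Y \<in> VF" "Z \<in> VF" "W \<in> VF"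
    have "curv4 D' g X Y Z W p - tensorK D P g X Y Z W p
       = ((curv4 D' g X Y Z W p - curv4 D g X Y Z W p)
          + (curv4 D' g X Y (J Z) (J W) p - curv4 D g X Y (J Z) (J W) p)) / 2"
      using curv_J[OF v, of p] by (simp add: tensorK_def field_simps)
    \<comment> \<open>Passing to \<open>(JZ, JW)\<close> multiplies \<open>h\<close> by \<open>\<delta>\<close> and \<open>\<theta>\<close> by \<open>-\<delta>\<close>, so the mixed terms change sign and cancel.\<close>
    also have "\<dots> = c / 2 * ((B Y Z p * B X W p - B X Z p * B Y W p)
        + (B Y (J Z) p * B X (J W) p - B X (J Z) p * B Y (J W) p))"
      unfolding diff[OF v] diff[OF v(1,2) vf_J[OF v(3)] vf_J[OF v(4)]]
      using \<delta> v by (auto simp: hJ \<theta>_J algebra_simps add_divide_distrib diff_divide_distrib)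
    also have "\<dots> = c * (\<alpha>\<^sup>2 + \<beta>\<^sup>2) / 2 * (pi1 g X Y Z W p + pi2 P g X Y Z W p) + c * \<alpha> * \<beta> * pi3 P g X Y Z W p"
      using v by (simp add: pi_eq JJ B_def power2_eq_square field_simps)
    finally show "curv4 D' g X Y Z W p = tensorK D P g X Y Z W p
      + c * (\<alpha>\<^sup>2 + \<beta>\<^sup>2) / 2 * (pi1 g X Y Z W p + pi2 P g X Y Z W p) + c * \<alpha> * \<beta> * pi3 P g X Y Z W p"
      by simp
  qed
qed

theorem tensorC_eq:
  assumes "x \<in> VF" "y \<in> VF" "z \<in> VF" "w \<in> VF"
  shows "tensorC n A P g (curv4 D' g) x y z w = tensorC n A P g (tensorK D P g) x y z w"
proof
  fix p
  obtain c where c: "\<And>X Y Z W. X \<in> VF \<Longrightarrow> Y \<in> VF \<Longrightarrow> Z \<in> VF \<Longrightarrow> W \<in> VF \<Longrightarrow>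
    curv4 D' g X Y Z W p = tensorK D P g X Y Z W p
      + c * (\<alpha>\<^sup>2 + \<beta>\<^sup>2) / 2 * (pi1 g X Y Z W p + pi2 P g X Y Z W p) + c * \<alpha> * \<beta> * pi3 P g X Y Z W p"
    by (rule curv_eq_K[of p]) (rule that)
  define a where "a = c * (\<alpha>\<^sup>2 + \<beta>\<^sup>2) / 2"
  define b where "b = c * \<alpha> * \<beta>"
  define L where "L X Y Z W q = a * pi1 g X Y Z W q + b * pi3 P g X Y Z W q + a * pi2 P g X Y Z W q"
    for X Y Z W q
  have R: "curv4 D' g X Y Z W p = tensorK D P g X Y Z W p + L X Y Z W p"
    if "X \<in> VF" "Y \<in> VF" "Z \<in> VF" "W \<in> VF" for X Y Z W
    unfolding c[OF that] L_def a_def[symmetric] b_def[symmetric] by (simp add: algebra_simps)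
  have s: "scal A g L p = 4 * real n * (real n - 1) * a" "scal_star A P g L p = 4 * real n * (real n - 1) * b"
    using scal_pi_comb[OF tr, of L p a b a] by (simp_all add: L_def dim algebra_simps)
  have sum_scal: "scal A g (curv4 D' g) p = scal A g (tensorK D P g) p + scal A g L p"
    "scal_star A P g (curv4 D' g) p = scal_star A P g (tensorK D P g) p + scal_star A P g L p"
    by (rule scal_add; rule R; assumption)+
  have "4 * real n * (real n - 1) \<noteq> 0" using n by simp
  then show "tensorC n A P g (curv4 D' g) x y z w p = tensorC n A P g (tensorK D P g) x y z w p"
    unfolding tensorC_def sum_scal s R[OF assms]
    by (simp add: L_def divide_simps) (simp add: algebra_simps)
qed

end

theorem theorem5p1:
  fixes A :: "('a::{t2_space,second_countable_topology}, 'm::finite) chart set"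
    and P :: "'a endo" and g :: "'a metric"
    and D D' :: "'a connection"
    and n :: nat and a b :: real
  assumes "riemannian_almost_product A P g"
    and "\<forall>p. endo_trace A P p = 0"
    and "CARD('m) = 2 * n" and "n \<ge> 2"
    and "levi_civita A g D"
    and "class_W3 n A D P g \<or> class_W6 n A D P g"
    and "closed_form A (lee A D P g)"
    and "natural_connection n A D P g a b D'"
    and "parallel_torsion A D'"
  shows "\<forall>x\<in>vfields A. \<forall>y\<in>vfields A. \<forall>z\<in>vfields A. \<forall>w\<in>vfields A.
    tensorC n A P g (curv4 D' g) x y z w = tensorC n A P g (tensorK D P g) x y z w"
proof -
  interpret almost_product A P g by (rule almost_product.intro[OF assms(1)])
  let ?\<theta> = "lee A D P g"
  obtain \<delta> :: real where \<delta>: "\<delta> = 1 \<or> \<delta> = - 1"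
    and F: "\<And>x y z p. x \<in> VF \<Longrightarrow> y \<in> VF \<Longrightarrow> z \<in> VF \<Longrightarrow> tensorF D P g x y z p =
      1 / (2 * real n) * ((G x y p + \<delta> * G x (J y) p) * ?\<theta> z p + (G x z p + \<delta> * G x (J z) p) * ?\<theta> y p)"
    and \<theta>_J: "\<And>x p. x \<in> VF \<Longrightarrow> ?\<theta> (J x) p = - \<delta> * ?\<theta> x p"
    using assms(6)
  proof
    assume "class_W3 n A D P g"
    then show ?thesis by (intro that[of 1]) (simp_all add: class_W3_def Let_def)
  next
    assume "class_W6 n A D P g"
    then show ?thesis by (intro that[of "- 1"]) (simp_all add: class_W6_def Let_def)
  qed
  have nat: "linear_connection A D'" "metric_connection A g D'"
    "\<And>x y. x \<in> VF \<Longrightarrow> y \<in> VF \<Longrightarrow> cov_endo D' P x y = 0"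
    "\<And>x y z p. x \<in> VF \<Longrightarrow> y \<in> VF \<Longrightarrow> z \<in> VF \<Longrightarrow> G (torsion D' x y) z p =
      1 / (2 * real n) * (G y z p * ?\<theta> (J x) p - G x z p * ?\<theta> (J y) p)
          + a * (G y z p * ?\<theta> x p - G x z p * ?\<theta> y p
                 + G y (J z) p * ?\<theta> (J x) p - G x (J z) p * ?\<theta> (J y) p)
          + b * (G y (J z) p * ?\<theta> x p - G x (J z) p * ?\<theta> y p
                 + G y z p * ?\<theta> (J x) p - G x z p * ?\<theta> (J y) p)"
    using assms(8) by (simp_all add: natural_connection_def Let_def)
  define \<alpha> where "\<alpha> = a - \<delta> * (1 / (2 * real n) + b)"
  define \<beta> where "\<beta> = b - \<delta> * a"
  have "\<alpha> + \<delta> * \<beta> = - \<delta> / (2 * real n)"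
    using \<delta> by (auto simp: \<alpha>_def \<beta>_def algebra_simps)
  then have nondeg: "\<alpha> + \<delta> * \<beta> \<noteq> 0" using \<delta> assms(4) by auto
  have tor: "G (torsion D' x y) z p = ?\<theta> x p * (\<alpha> * G y z p + \<beta> * G y (J z) p)
      - ?\<theta> y p * (\<alpha> * G x z p + \<beta> * G x (J z) p)"
    if "x \<in> VF" "y \<in> VF" "z \<in> VF" for x y z p
    unfolding nat(4)[OF that] \<theta>_J[OF that(1)] \<theta>_J[OF that(2)] \<alpha>_def \<beta>_def
    by (simp add: algebra_simps)
  interpret parallel_natural A P g n D D' \<delta> \<alpha> \<beta> "lee A D P g" "\<lambda>x y p. \<alpha> * G x y p + \<beta> * G x (J y) p"
  proof unfold_locales
    show "D' x (J y) = J (D' x y)" if "x \<in> VF" "y \<in> VF" for x y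
      using nat(3)[OF that] by (simp add: cov_endo_def)
  qed (use assms nat(1,2) \<delta> F \<theta>_J tor nondeg in auto)
  show ?thesis using tensorC_eq by blast
qed

end
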